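(* Let $f_1,\dots,f_n:\mathbb{R}^p\to\mathbb{R}$ be twice differentiable and $F(\mathbf{x})=\frac1n\sum_{i=1}^n f_i(\mathbf{x})$. Assume that there are constants $0<K_i<\infty$ with $0\preceq\nabla^2 f_i(\mathbf{x})\preceq K_i\mathbb{I}$ for all $\mathbf{x}\in\mathbb{R}^p$ and $i=1,\dots,n$, and constants $0<\gamma\le K<\infty$ with $\gamma\mathbb{I}\preceq\nabla^2F(\mathbf{x})\preceq K\mathbb{I}$ for all $\mathbf{x}\in\mathbb{R}^p$; let $\mathbf{x}^*$ be the minimizer of $F$. Let $0<\delta<1$, $0<\epsilon_1\le1/2$, $0<\epsilon_2<1$, $0<\beta<1$, $\widehat\alpha\ge1$ and $$\sigma\ge\frac{4\tilde\kappa}{1-\beta}.$$ For any $\mathbf{x}^{(k)}\in\mathbb{R}^p$, perform one iteration of the algorithm described in the context (sub-sampled Hessian and gradient, exact update) at $\mathbf{x}^{(k)}$. Then the following holds with probability $(1-\delta)^2$: (i) if the algorithm stops at this iteration ("STOP"), then $\|\nabla F(\mathbf{x}^{(k)})\|<(1+\sigma)\epsilon_2$; (ii) otherwise, $$F(\mathbf{x}^{(k+1)})-F(\mathbf{x}^* )\le(1-\rho)\big(F(\mathbf{x}^{(k)})-F(\mathbf{x}^* )\big),\qquad\rho=\frac{8\alpha_k\beta}{9\tilde\kappa},$$ and the step size is at least $$\alpha_k\ge\frac{(1-\beta)(1-\epsilon_1)}{\kappa}.$$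
   Context: Condition numbers: $\kappa=K/\gamma$. For an integer $1\le q\le n$, $\widehat K_q$ is the average of the $q$ largest values among $K_1,\dots,K_n$, and $\kappa_q=\widehat K_q/\gamma$. With $\mathcal{S}_H$ the Hessian sample, $\tilde\kappa=\kappa_1$ if $\mathcal{S}_H$ is drawn with replacement, and $\tilde\kappa=\kappa_{|\mathcal{S}_H|}$ if it is drawn without replacement. Algorithm (one iteration). (1) A collection $\mathcal{S}_H$ of indices of size $|\mathcal{S}_H|\ge 2\kappa_1\ln(p/\delta)/\epsilon_1^2$ is drawn from $\{1,\dots,n\}$ uniformly at random, with or without replacement, and $H(\mathbf{x}^{(k)})=\frac1{|\mathcal{S}_H|}\sum_{j\in\mathcal{S}_H}\nabla^2f_j(\mathbf{x}^{(k)})$. (2) With $G(\mathbf{x}^{(k)})$ a number such that $\|\nabla f_i(\mathbf{x}^{(k)})\|\le G(\mathbf{x}^{(k)})$ for all $i$, a collection $\mathcal{S}_{\mathbf{g}}$ of size $|\mathcal{S}_{\mathbf{g}}|\ge\frac{G(\mathbf{x}^{(k)})^2}{\epsilon_2^2}\big(1+\sqrt{8\ln(1/\delta)}\big)^2$ is drawn, independently of $\mathcal{S}_H$, from $\{1,\dots,n\}$ uniformly at random with replacement, and $\mathbf{g}(\mathbf{x}^{(k)})=\frac1{|\mathcal{S}_{\mathbf{g}}|}\sum_{j\in\mathcal{S}_{\mathbf{g}}}\nabla f_j(\mathbf{x}^{(k)})$. (3) If $\|\mathbf{g}(\mathbf{x}^{(k)})\|<\sigma\epsilon_2$, STOP.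 (4) Otherwise $\mathbf{x}^{(k+1)}=\mathbf{x}^{(k)}+\alpha_k\mathbf{p}_k$, where $\mathbf{p}_k=-[H(\mathbf{x}^{(k)})]^{-1}\mathbf{g}(\mathbf{x}^{(k)})$ and $\alpha_k$ is the largest $\alpha\le\widehat\alpha$ such that $F(\mathbf{x}^{(k)}+\alpha\mathbf{p}_k)\le F(\mathbf{x}^{(k)})+\alpha\beta\,\mathbf{p}_k^T\mathbf{g}(\mathbf{x}^{(k)})$. "With probability $q$" means with probability at least $q$ over the draws of the samples. $A\preceq B$ means $B-A$ is symmetric positive semi-definite. *)

theory Defs
  imports "HOL-Probability.Probability"
begin

definition grad :: "(real^'p \<Rightarrow> real) \<Rightarrow> real^'p \<Rightarrow> real^'p" where
  "grad f x = (\<chi> i. frechet_derivative f (at x) (axis i 1))"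

definition hessian :: "(real^'p \<Rightarrow> real) \<Rightarrow> real^'p \<Rightarrow> real^'p^'p" where
  "hessian f x = jacobian (grad f) (at x)"

definition twice_differentiable :: "(real^'p \<Rightarrow> real) \<Rightarrow> bool" where
  "twice_differentiable f \<longleftrightarrow>
     (\<forall>x. f differentiable (at x)) \<and> (\<forall>x. grad f differentiable (at x))"

definition psd :: "real^'p^'p \<Rightarrow> bool" where
  "psd A \<longleftrightarrow> transpose A = A \<and> (\<forall>v. 0 \<le> v \<bullet> (A *v v))"

definition loewner_le :: "real^'p^'p \<Rightarrow> real^'p^'p \<Rightarrow> bool"  (infix \<open>\<preceq>\<^sub>L\<close> 50) where
  "A \<preceq>\<^sub>L B \<longleftrightarrow> psd (B - A)"

definition avg_largest :: "nat \<Rightarrow> (nat \<Rightarrow> real) \<Rightarrow> nat \<Rightarrow> real" where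
  "avg_largest n Ks q = sum_list (take q (rev (sort (map Ks [1..<n+1])))) / real q"

definition cond_number :: "nat \<Rightarrow> (nat \<Rightarrow> real) \<Rightarrow> real \<Rightarrow> nat \<Rightarrow> real" where
  "cond_number n Ks \<gamma> q = avg_largest n Ks q / \<gamma>"

datatype sampling = With_Replacement | Without_Replacement

text \<open>A collection of indices is the list of its successive draws, so that repeated indices are
  counted with multiplicity. For draws without replacement the definition is meaningful only
  for sizes at most \<open>n\<close>.\<close>

fun sample :: "sampling \<Rightarrow> nat \<Rightarrow> nat \<Rightarrow> nat list pmf" where
  "sample With_Replacement n s = replicate_pmf s (pmf_of_set {1..n})"
| "sample Without_Replacement n s =
     pmf_of_set {xs. length xs = s \<and> distinct xs \<and> set xs \<subseteq> {1..n}}"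

fun cond_tilde :: "sampling \<Rightarrow> nat \<Rightarrow> (nat \<Rightarrow> real) \<Rightarrow> real \<Rightarrow> nat \<Rightarrow> real" where
  "cond_tilde With_Replacement n Ks \<gamma> s = cond_number n Ks \<gamma> 1"
| "cond_tilde Without_Replacement n Ks \<gamma> s = cond_number n Ks \<gamma> s"

definition sub_hessian :: "(nat \<Rightarrow> real^'p \<Rightarrow> real) \<Rightarrow> real^'p \<Rightarrow> nat list \<Rightarrow> real^'p^'p" where
  "sub_hessian f x S = (1 / real (length S)) *\<^sub>R (\<Sum>j\<leftarrow>S. hessian (f j) x)"

definition sub_grad :: "(nat \<Rightarrow> real^'p \<Rightarrow> real) \<Rightarrow> real^'p \<Rightarrow> nat list \<Rightarrow> real^'p" where
  "sub_grad f x S = (1 / real (length S)) *\<^sub>R (\<Sum>j\<leftarrow>S. grad (f j) x)"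

definition armijo ::
  "(real^'p \<Rightarrow> real) \<Rightarrow> real \<Rightarrow> real^'p \<Rightarrow> real^'p \<Rightarrow> real^'p \<Rightarrow> real \<Rightarrow> bool" where
  "armijo F \<beta> x p g \<alpha> \<longleftrightarrow> F (x + \<alpha> *\<^sub>R p) \<le> F x + \<alpha> * \<beta> * (p \<bullet> g)"

definition step_size ::
  "(real^'p \<Rightarrow> real) \<Rightarrow> real \<Rightarrow> real \<Rightarrow> real^'p \<Rightarrow> real^'p \<Rightarrow> real^'p \<Rightarrow> real" where
  "step_size F \<alpha>max \<beta> x p g = (GREATEST \<alpha>. \<alpha> \<le> \<alpha>max \<and> armijo F \<beta> x p g \<alpha>)"

text \<open>The largest admissible step exists for every direction: the admissible set is closed,
  bounded above, and contains \<open>0\<close>.\<close>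

lemma step_size_greatest:
  fixes F :: "real^'p \<Rightarrow> real"
  assumes "continuous_on UNIV F" "0 \<le> \<alpha>max"
  shows "step_size F \<alpha>max \<beta> x p g \<le> \<alpha>max"
    and "armijo F \<beta> x p g (step_size F \<alpha>max \<beta> x p g)"
    and "\<And>\<alpha>. \<alpha> \<le> \<alpha>max \<Longrightarrow> armijo F \<beta> x p g \<alpha> \<Longrightarrow> \<alpha> \<le> step_size F \<alpha>max \<beta> x p g"
proof -
  define S where "S = {\<alpha>. \<alpha> \<le> \<alpha>max \<and> armijo F \<beta> x p g \<alpha>}"
  have c: "continuous_on UNIV (\<lambda>\<alpha>. F (x + \<alpha> *\<^sub>R p))"
    by (rule continuous_on_compose2[OF assms(1)]) (auto intro!: continuous_intros)
  have S_eq: "S = {\<alpha>. \<alpha> \<le> \<alpha>max} \<inter> {\<alpha>. F (x + \<alpha> *\<^sub>R p) \<le> F x + \<alpha> * \<beta> * (p \<bullet> g)}"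
    by (auto simp: S_def armijo_def)
  have "closed S"
    unfolding S_eq by (intro closed_Int closed_Collect_le c continuous_intros)
  moreover have ne: "S \<noteq> {}"
    using assms(2) by (auto simp: S_def armijo_def intro!: exI[of _ 0])
  moreover have bdd: "bdd_above S"
    by (auto simp: S_def bdd_above_def)
  ultimately have Sup: "Sup S \<in> S"
    by (intro closed_contains_Sup)
  have "step_size F \<alpha>max \<beta> x p g = Sup S"
    unfolding step_size_def
    using Sup by (intro Greatest_equality) (auto simp: S_def intro!: cSup_upper bdd[unfolded S_def])
  with Sup bdd show "step_size F \<alpha>max \<beta> x p g \<le> \<alpha>max"
    and "armijo F \<beta> x p g (step_size F \<alpha>max \<beta> x p g)"
    and "\<And>\<alpha>. \<alpha> \<le> \<alpha>max \<Longrightarrow> armijo F \<beta> x p g \<alpha> \<Longrightarrow> \<alpha> \<le> step_size F \<alpha>max \<beta> x p g"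
    by (auto simp: S_def intro!: cSup_upper)
qed

end

theory Submission
  imports Defs "HOL-Combinatorics.Multiset_Permutations"
begin

text \<open>
  Only two random events matter, and the step is deterministic on their intersection: the sampled
  Hessian \<open>H\<close> has smallest eigenvalue at least \<open>(1 - \<epsilon>\<^sub>1)\<gamma>\<close>, and the sampled gradient is within \<open>\<epsilon>\<^sub>2\<close> of \<open>\<nabla>F\<close>.

  The first is a matrix Chernoff bound, from Markov's inequality for \<open>tr exp (-\<theta> \<Sum>X)\<close>. One draw
  multiplies the expected trace exponential by at most \<open>1 - \<gamma> (1 - exp (-\<theta>R)) / R\<close>, where \<open>R\<close> is the
  largest \<open>K\<^sub>i\<close>; this combines the Golden--Thompson inequality with the chord bound for the convex
  function \<open>t \<mapsto> exp (-\<theta>t)\<close> on \<open>[0, R]\<close>. To avoid matrix exponentials, Golden--Thompson is proved for the powers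
  \<open>(1 + A/N)^N\<close> with \<open>N = 2^k\<close> and the limit is taken only in the trace. Drawing without
  replacement is compared with an independent draw by convexity of \<open>tr exp\<close>.
  The second event is handled as in McDiarmid's inequality, by conditioning on one draw after the
  other and applying Hoeffding's lemma to the conditional expectation of the norm.

  On both events, \<open>\<epsilon>\<^sub>2 \<parallel>p\<parallel> \<le> (1 - \<beta>) p\<^sup>T H p / 2\<close>, so the gradient error costs at most half of the slack
  in the Armijo condition; and since \<open>\<sigma> \<ge> 2\<close>, \<open>\<parallel>\<nabla>F\<parallel>\<^sup>2 \<le> 9/4 \<parallel>g\<parallel>\<^sup>2\<close>, which gives the constant \<open>8/9\<close>.
\<close>

subsection \<open>Symmetric matrices and orthonormal bases\<close>

lemma symmetric_inner:
  fixes A :: "real^'n^'n"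
  assumes "transpose A = A"
  shows "(A *v x) \<bullet> y = x \<bullet> (A *v y)"
  by (metis assms dot_lmul_matrix vector_transpose_matrix)

definition orthonormal_basis :: "'a::euclidean_space set \<Rightarrow> bool" where
  "orthonormal_basis B \<longleftrightarrow> pairwise orthogonal B \<and> (\<forall>b\<in>B. norm b = 1) \<and> span B = UNIV"

lemma orthonormal_independent:
  fixes B :: "'a::euclidean_space set"
  assumes "pairwise orthogonal B" "\<forall>b\<in>B. norm b = 1"
  shows "independent B"
  using assms by (intro pairwise_orthogonal_independent) auto

lemma orthonormal_basis_finite: "orthonormal_basis B \<Longrightarrow> finite B"
  unfolding orthonormal_basis_def
  using orthonormal_independent independent_imp_finite by blast

lemma orthonormal_basis_card:
  fixes B :: "'a::euclidean_space set"
  shows "orthonormal_basis B \<Longrightarrow> card B = DIM('a)"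
  unfolding orthonormal_basis_def
  using orthonormal_independent[of B] dim_eq_card[of B UNIV] by simp

lemma orthonormal_basis_norm: "orthonormal_basis B \<Longrightarrow> b \<in> B \<Longrightarrow> norm b = 1"
  by (simp add: orthonormal_basis_def)

lemma orthonormal_basis_representation:
  assumes "orthonormal_basis B"
  shows "(\<Sum>b\<in>B. (x \<bullet> b) *\<^sub>R b) = x"
  using assms orthonormal_basis_finite[OF assms]
  by (intro orthonormal_basis_expand) (auto simp: orthonormal_basis_def)

lemma orthonormal_basis_inner:
  assumes "orthonormal_basis B"
  shows "(\<Sum>b\<in>B. (x \<bullet> b) * (y \<bullet> b)) = x \<bullet> y"
proof -
  have "x \<bullet> y = (\<Sum>b\<in>B. (x \<bullet> b) *\<^sub>R b) \<bullet> y"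
    using orthonormal_basis_representation[OF assms] by simp
  also have "\<dots> = (\<Sum>b\<in>B. (x \<bullet> b) * (y \<bullet> b))"
    by (simp only: inner_sum_left inner_scaleR_left inner_commute[of y])
  finally show ?thesis by simp
qed

lemma orthonormal_basis_norm_sum:
  assumes "orthonormal_basis B"
  shows "(\<Sum>b\<in>B. (x \<bullet> b)\<^sup>2) = (norm x)\<^sup>2"
  using orthonormal_basis_inner[OF assms, of x x]
  by (simp add: power2_eq_square power2_norm_eq_inner dot_square_norm)

lemma inner_matrix_vector_sum:
  fixes A :: "real^'n^'n"
  shows "x \<bullet> (A *v y) = (\<Sum>i\<in>UNIV. \<Sum>j\<in>UNIV. A$i$j * (x$i * y$j))"
  by (simp add: inner_vec_def matrix_vector_mult_def sum_distrib_left algebra_simps)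

lemma trace_orthonormal_basis:
  fixes A :: "real^'n^'n"
  assumes "orthonormal_basis B"
  shows "trace A = (\<Sum>b\<in>B. b \<bullet> (A *v b))"
proof -
  \<comment> \<open>Parseval for two coordinate vectors: the square matrix with columns
    \<open>B\<close> is orthogonal, so its rows are orthonormal as well.\<close>
  have \<delta>: "(\<Sum>b\<in>B. b$i * b$j) = (if i = j then 1 else 0)" for i j
    using orthonormal_basis_inner[OF assms, of "axis i 1" "axis j 1"]
    by (simp add: inner_axis_axis inner_axis inner_axis') (auto simp: axis_def)
  have "(\<Sum>b\<in>B. b \<bullet> (A *v b)) = (\<Sum>i\<in>UNIV. \<Sum>j\<in>UNIV. A$i$j * (\<Sum>b\<in>B. b$i * b$j))"
    unfolding inner_matrix_vector_sum sum_distrib_left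
    by (subst sum.swap, rule sum.cong[OF refl], rule sum.swap)
  also have "\<dots> = trace A"
    by (simp add: \<delta> trace_def if_distrib[where f = "\<lambda>x. _ * x"] cong: if_cong)
  finally show ?thesis by simp
qed

lemma orthonormal_basis_axis: "orthonormal_basis (range (\<lambda>i. axis i 1 :: real^'n))"
proof -
  have "range (\<lambda>i. axis i 1 :: real^'n) = Basis"
    by (auto simp: Basis_vec_def)
  then show ?thesis
    by (auto simp: orthonormal_basis_def pairwise_def orthogonal_def inner_Basis)
qed

text \<open>Each eigenvalue is written as a Rayleigh quotient, so an eigenbasis is a bare set of
  vectors and no eigenvalue function has to be carried along.\<close>

definition eigenbasis :: "real^'n^'n \<Rightarrow> (real^'n) set \<Rightarrow> bool" where
  "eigenbasis A B \<longleftrightarrow> orthonormal_basis B \<and> (\<forall>b\<in>B. A *v b = (b \<bullet> (A *v b)) *\<^sub>R b)"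

text \<open>Discriminant of the nonnegative quadratic polynomial in \<open>t\<close> given by the
  form at \<open>u + t *\<^sub>R v\<close>. Positivity is asked on a subspace because the
  eigenvector search knows it only on an invariant subspace.\<close>

lemma psd_Cauchy_Schwarz:
  fixes A :: "real^'n^'n"
  assumes sym: "transpose A = A" and V: "subspace V" and pos: "\<And>v. v \<in> V \<Longrightarrow> 0 \<le> v \<bullet> (A *v v)"
    and "u \<in> V" "v \<in> V"
  shows "(u \<bullet> (A *v v))\<^sup>2 \<le> (u \<bullet> (A *v u)) * (v \<bullet> (A *v v))"
proof -
  define a b c where "a = u \<bullet> (A *v u)" and "b = u \<bullet> (A *v v)" and "c = v \<bullet> (A *v v)"
  have vu: "v \<bullet> (A *v u) = b"
    using symmetric_inner[OF sym, of v u] by (simp add: b_def inner_commute)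
  have q: "0 \<le> a + 2 * t * b + t\<^sup>2 * c" for t
  proof -
    have "u + t *\<^sub>R v \<in> V"
      using assms by (simp add: subspace_add subspace_scale)
    from pos[OF this] show ?thesis
      by (simp add: matrix_vector_right_distrib matrix_vector_mult_scaleR inner_add_left inner_add_right
          vu a_def[symmetric] b_def[symmetric] c_def[symmetric] power2_eq_square algebra_simps)
  qed
  have c: "0 \<le> c" and a: "0 \<le> a" using pos assms by (auto simp: a_def c_def)
  have "b\<^sup>2 \<le> a * c"
  proof (cases "c = 0")
    case True
    have "b = 0"
    proof (rule ccontr)
      assume "b \<noteq> 0"
      \<comment> \<open>With \<open>c = 0\<close> the polynomial is affine in \<open>t\<close>, and
        the chosen \<open>t\<close> gives it the value \<open>-1\<close>.\<close>
      then show False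
        using q[of "- (a + 1) / (2 * b)"] True by (simp add: field_simps)
    qed
    then show ?thesis using a c by simp
  next
    case False
    with c have "c > 0" by simp
    then show ?thesis
      using q[of "- b / c"] by (simp add: field_simps power2_eq_square)
  qed
  then show ?thesis by (simp add: a_def b_def c_def)
qed

text \<open>Let \<open>u\<close> maximise the form on the unit sphere of \<open>V\<close>. Then
  \<open>M = \<mu> *\<^sub>R mat 1 - A\<close> is nonnegative on \<open>V\<close> and vanishes at
  \<open>u\<close> as a form, so Cauchy--Schwarz for \<open>M *v u\<close> and \<open>u\<close>
  forces \<open>M *v u = 0\<close>.\<close>

lemma symmetric_eigenvector_exists:
  fixes A :: "real^'n^'n"
  assumes sym: "transpose A = A" and V: "subspace V" and inv: "\<And>v. v \<in> V \<Longrightarrow> A *v v \<in> V"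
    and nz: "V \<noteq> {0}"
  obtains u where "u \<in> V" "norm u = 1" "A *v u = (u \<bullet> (A *v u)) *\<^sub>R u"
proof -
  have "0 \<in> V" using V by (rule subspace_0)
  with nz obtain w where w: "w \<in> V" "w \<noteq> 0" by auto
  define S where "S = V \<inter> sphere 0 1"
  have "compact S"
    unfolding S_def using closed_subspace[OF V] by (intro closed_Int_compact) auto
  moreover have "(1 / norm w) *\<^sub>R w \<in> S"
    using w V by (auto simp: S_def subspace_scale)
  then have "S \<noteq> {}" by auto
  moreover have "continuous_on S (\<lambda>v. v \<bullet> (A *v v))"
    by (intro continuous_intros linear_continuous_on matrix_vector_mul_bounded_linear)
  ultimately obtain u where u: "u \<in> S" and max: "\<And>v. v \<in> S \<Longrightarrow> v \<bullet> (A *v v) \<le> u \<bullet> (A *v u)"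
    using continuous_attains_sup by metis
  define \<mu> where "\<mu> = u \<bullet> (A *v u)"
  define M where "M = \<mu> *\<^sub>R mat 1 - A"
  have Mv: "M *v v = \<mu> *\<^sub>R v - A *v v" for v
    by (simp add: M_def matrix_vector_mult_diff_rdistrib scaleR_matrix_vector_assoc[symmetric])
  have symM: "transpose M = M"
  proof -
    have "M $ j $ i = M $ i $ j" for i j
      using sym by (auto simp: M_def transpose_def vec_eq_iff mat_def)
    then show ?thesis by (simp add: transpose_def vec_eq_iff)
  qed
  have uV: "u \<in> V" and u1: "norm u = 1" using u by (auto simp: S_def)
  have pos: "0 \<le> v \<bullet> (M *v v)" if "v \<in> V" for v
  proof (cases "v = 0")
    case False
    have "(1 / norm v) *\<^sub>R v \<in> S"
      using that False V by (auto simp: S_def subspace_scale)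
    from max[OF this] have "(v \<bullet> (A *v v)) / (norm v)\<^sup>2 \<le> \<mu>"
      by (simp add: matrix_vector_mult_scaleR \<mu>_def power2_eq_square)
    then have "v \<bullet> (A *v v) \<le> \<mu> * (norm v)\<^sup>2"
      using False by (simp add: field_simps)
    then show ?thesis
      by (simp add: Mv inner_diff_right power2_norm_eq_inner)
  qed simp
  have "u \<bullet> (M *v u) = 0"
    using u1 by (simp add: Mv inner_diff_right \<mu>_def power2_norm_eq_inner[symmetric])
  moreover have MuV: "M *v u \<in> V"
    using uV V inv by (simp add: Mv subspace_diff subspace_scale)
  ultimately have "(M *v u) \<bullet> (M *v u) = 0"
    using psd_Cauchy_Schwarz[OF symM V pos MuV uV] by simp
  then have "A *v u = \<mu> *\<^sub>R u" by (simp add: Mv)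
  with uV u1 that show ?thesis by (simp add: \<mu>_def)
qed

text \<open>An orthonormal set of eigenvectors of greatest size spans: its orthogonal complement is
  invariant under \<open>A\<close> and, if nonzero, would contain a further unit
  eigenvector.\<close>

lemma eigenbasis_exists:
  fixes A :: "real^'n^'n"
  assumes sym: "transpose A = A"
  obtains B where "eigenbasis A B"
proof -
  define P where "P B \<longleftrightarrow> pairwise orthogonal B \<and> (\<forall>b\<in>B. norm b = 1) \<and>
      (\<forall>b\<in>B. A *v b = (b \<bullet> (A *v b)) *\<^sub>R b)" for B
  have card_le: "card B \<le> CARD('n)" and fin: "finite B" if "P B" for B
    using that orthonormal_independent[of B] independent_bound[of B] by (auto simp: P_def)
  have "P {}" by (simp add: P_def)
  then have "\<exists>B. P B \<and> (\<forall>C. P C \<longrightarrow> card C \<le> card B)"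
    using card_le by (intro ex_has_greatest_nat[where k = "{}" and b = "Suc CARD('n)"]) (auto simp: less_Suc_eq_le)
  then obtain B where B: "P B" and max: "\<And>C. P C \<Longrightarrow> card C \<le> card B" by blast
  define V where "V = {v. \<forall>b\<in>B. b \<bullet> v = 0}"
  have V: "subspace V"
    by (auto simp: V_def subspace_def inner_add_right)
  have inv: "A *v v \<in> V" if "v \<in> V" for v
    unfolding V_def
  proof (intro CollectI ballI)
    fix b assume b: "b \<in> B"
    have "b \<bullet> (A *v v) = (A *v b) \<bullet> v" using symmetric_inner[OF sym] by simp
    also have "\<dots> = (b \<bullet> (A *v b)) * (b \<bullet> v)"
      using B b by (metis P_def inner_scaleR_left)
    also have "\<dots> = 0" using that b by (simp add: V_def)
    finally show "b \<bullet> (A *v v) = 0" .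
  qed
  have "span B = UNIV"
  proof (rule ccontr)
    assume "span B \<noteq> UNIV"
    then have "span B \<subset> span UNIV" by auto
    then obtain x where x: "x \<noteq> 0" "\<And>y. y \<in> span B \<Longrightarrow> orthogonal x y"
      by (rule orthogonal_to_subspace_exists_gen) (rule that)
    then have "x \<in> V" by (auto simp: V_def span_base orthogonal_def inner_commute)
    with x have "V \<noteq> {0}" by auto
    then obtain u where u: "u \<in> V" "norm u = 1" "A *v u = (u \<bullet> (A *v u)) *\<^sub>R u"
      using symmetric_eigenvector_exists[OF sym V inv] by blast
    have "u \<notin> B"
      using u by (auto simp: V_def)
    moreover have "P (insert u B)"
      using B u by (auto simp: P_def pairwise_insert V_def orthogonal_def inner_commute)
    ultimately show False using max[of "insert u B"] fin[OF B] by simp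
  qed
  with B have "eigenbasis A B" by (simp add: P_def eigenbasis_def orthonormal_basis_def)
  with that show ?thesis by blast
qed

subsection \<open>Powers of matrices and the Golden--Thompson inequality\<close>

primrec mpow :: "real^'n^'n \<Rightarrow> nat \<Rightarrow> real^'n^'n" where
  "mpow A 0 = mat 1"
| "mpow A (Suc k) = A ** mpow A k"

lemma mpow_add: "mpow A (j + k) = mpow A j ** mpow A k"
  by (induction j) (simp_all add: matrix_mul_assoc)

lemma mpow_commute: "A ** mpow A k = mpow A k ** A"
  using mpow_add[of A k 1] by simp

lemma mpow_double: "mpow A (2 * k) = mpow (A ** A) k"
  by (induction k) (simp_all add: matrix_mul_assoc)

lemma transpose_mpow: "transpose A = A \<Longrightarrow> transpose (mpow A k) = mpow A k"
  by (induction k) (simp_all add: matrix_transpose_mul transpose_mat mpow_commute)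

lemma mpow_eigenvector:
  assumes "A *v b = c *\<^sub>R b"
  shows "mpow A k *v b = c ^ k *\<^sub>R b"
  by (induction k) (simp_all add: assms matrix_vector_mul_assoc[symmetric] matrix_vector_mult_scaleR)

lemma mpow_mult_swap:
  fixes A B :: "real^'n^'n"
  shows "mpow (A ** B) (Suc k) = A ** mpow (B ** A) k ** B"
proof (induction k)
  case (Suc k)
  have "mpow (A ** B) (Suc (Suc k)) = A ** (B ** A ** mpow (B ** A) k) ** B"
    using Suc by (simp add: matrix_mul_assoc)
  then show ?case by simp
qed simp

lemma trace_mpow_mult_commute:
  fixes A B :: "real^'n^'n"
  shows "trace (mpow (A ** B) k) = trace (mpow (B ** A) k)"
proof (cases k)
  case (Suc m)
  have "trace (mpow (A ** B) (Suc m)) = trace (B ** (A ** mpow (B ** A) m))"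
    unfolding mpow_mult_swap by (rule trace_mul_sym)
  with Suc show ?thesis by (simp add: matrix_mul_assoc)
qed simp

lemma trace_mult_transpose:
  fixes A B :: "real^'n^'n"
  shows "trace (A ** transpose B) = (\<Sum>i\<in>UNIV. \<Sum>j\<in>UNIV. A$i$j * B$i$j)"
  by (simp add: trace_def matrix_matrix_mult_def transpose_def)

text \<open>The arithmetic-mean form of Cauchy--Schwarz for the Frobenius inner product. It loses
  nothing here, since in its uses the two traces on the right coincide.\<close>

lemma trace_Cauchy_Schwarz:
  fixes A B :: "real^'n^'n"
  shows "trace (A ** B) \<le> (trace (A ** transpose A) + trace (transpose B ** B)) / 2"
proof -
  have am: "x * y \<le> (x * x + y * y) / 2" for x y :: real
    using sum_squares_bound[of x y] by (simp add: power2_eq_square)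
  have "trace (A ** B) = (\<Sum>i\<in>UNIV. \<Sum>j\<in>UNIV. A$i$j * transpose B$i$j)"
    using trace_mult_transpose[of A "transpose B"] by simp
  also have "\<dots> \<le> (\<Sum>i\<in>UNIV. \<Sum>j\<in>UNIV. (A$i$j * A$i$j + transpose B$i$j * transpose B$i$j) / 2)"
    by (intro sum_mono am)
  also have "\<dots> = (trace (A ** transpose A) + trace (transpose B ** B)) / 2"
    using trace_mult_transpose[of A A] trace_mult_transpose[of "transpose B" "transpose B"]
    by (simp add: sum.distrib add_divide_distrib sum_divide_distrib)
  finally show ?thesis .
qed

text \<open>The two inequalities feed each other: the second one reduces the first from \<open>X\<close>, \<open>Y\<close> to
  their squares, and the first one, for \<open>M\<^sup>T M\<close> and \<open>M M\<^sup>T\<close>, is what raises \<open>k\<close> in the second.\<close>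

lemma trace_mpow_power2_aux:
  fixes X Y M :: "real^'n^'n"
  shows "(\<forall>X Y :: real^'n^'n. transpose X = X \<longrightarrow> transpose Y = Y \<longrightarrow>
            trace (mpow (X ** Y) (2 ^ k)) \<le> trace (mpow X (2 ^ k) ** mpow Y (2 ^ k)))
       \<and> (\<forall>M :: real^'n^'n. trace (mpow M (2 ^ Suc k)) \<le> trace (mpow (M ** transpose M) (2 ^ k)))"
proof (induction k)
  case 0
  have "trace (M ** M) \<le> trace (M ** transpose M)" for M :: "real^'n^'n"
    using trace_Cauchy_Schwarz[of M M] trace_mul_sym[of "transpose M" M] by simp
  then show ?case by (simp add: numeral_2_eq_2)
next
  case (Suc k)
  then have GT: "\<And>X Y :: real^'n^'n. transpose X = X \<Longrightarrow> transpose Y = Y \<Longrightarrow>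
            trace (mpow (X ** Y) (2 ^ k)) \<le> trace (mpow X (2 ^ k) ** mpow Y (2 ^ k))"
    and L: "\<And>M :: real^'n^'n. trace (mpow M (2 ^ Suc k)) \<le> trace (mpow (M ** transpose M) (2 ^ k))"
    by blast+
  show ?case
  proof (intro conjI allI impI)
    fix X Y :: "real^'n^'n" assume XY: "transpose X = X" "transpose Y = Y"
    \<comment> \<open>The product of \<open>X ** Y\<close> with its transpose is
      \<open>X ** Y ** Y ** X\<close>; cyclic invariance brings the two factors \<open>X\<close>
      together, and the induction hypothesis applies to the squares.\<close>
    have "trace (mpow (X ** Y) (2 ^ Suc k)) \<le> trace (mpow ((X ** (Y ** Y)) ** X) (2 ^ k))"
      using L[of "X ** Y"] XY by (simp add: matrix_transpose_mul matrix_mul_assoc)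
    also have "\<dots> = trace (mpow ((X ** X) ** (Y ** Y)) (2 ^ k))"
      by (subst trace_mpow_mult_commute) (simp add: matrix_mul_assoc)
    also have "\<dots> \<le> trace (mpow (X ** X) (2 ^ k) ** mpow (Y ** Y) (2 ^ k))"
      using XY by (intro GT) (simp_all add: matrix_transpose_mul)
    finally show "trace (mpow (X ** Y) (2 ^ Suc k)) \<le> trace (mpow X (2 ^ Suc k) ** mpow Y (2 ^ Suc k))"
      by (simp add: mpow_double)
  next
    fix M :: "real^'n^'n"
    define P Q where "P = transpose M ** M" and "Q = M ** transpose M"
    have sym: "transpose P = P" "transpose Q = Q"
      by (simp_all add: P_def Q_def matrix_transpose_mul)
    have tr: "trace (mpow P (2 ^ Suc k)) = trace (mpow Q (2 ^ Suc k))"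
      unfolding P_def Q_def by (rule trace_mpow_mult_commute)
    have sq: "mpow R (2 ^ k) ** mpow R (2 ^ k) = mpow R (2 ^ Suc k)" for R :: "real^'n^'n"
      using mpow_add[of R "2 ^ k" "2 ^ k"] by (simp add: mult_2)
    \<comment> \<open>The induction hypothesis is used for \<open>M ** M\<close>; moving one
      transpose cyclically turns its right side into a power of \<open>P ** Q\<close>, a product of
      symmetric matrices whose powers have equal traces.\<close>
    have "trace (mpow M (2 ^ Suc (Suc k))) = trace (mpow (M ** M) (2 ^ Suc k))"
      using mpow_double[of M "2 ^ Suc k"] by (simp only: power_Suc)
    also have "\<dots> \<le> trace (mpow ((M ** (M ** transpose M)) ** transpose M) (2 ^ k))"
      using L[of "M ** M"] by (simp add: matrix_transpose_mul matrix_mul_assoc)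
    also have "\<dots> = trace (mpow (P ** Q) (2 ^ k))"
      unfolding P_def Q_def by (subst trace_mpow_mult_commute) (simp add: matrix_mul_assoc)
    also have "\<dots> \<le> trace (mpow P (2 ^ k) ** mpow Q (2 ^ k))"
      using sym by (rule GT)
    also have "\<dots> \<le> (trace (mpow P (2 ^ Suc k)) + trace (mpow Q (2 ^ Suc k))) / 2"
      using trace_Cauchy_Schwarz[of "mpow P (2 ^ k)" "mpow Q (2 ^ k)"] sym
      by (simp add: transpose_mpow sq)
    also have "\<dots> = trace (mpow Q (2 ^ Suc k))" using tr by simp
    finally show "trace (mpow M (2 ^ Suc (Suc k))) \<le> trace (mpow (M ** transpose M) (2 ^ Suc k))"
      by (simp add: Q_def)
  qed
qed

lemma trace_mpow_mult_le:
  fixes X Y :: "real^'n^'n"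
  assumes "transpose X = X" "transpose Y = Y"
  shows "trace (mpow (X ** Y) (2 ^ k)) \<le> trace (mpow X (2 ^ k) ** mpow Y (2 ^ k))"
  using trace_mpow_power2_aux[of k] assms by blast

subsection \<open>The Lie--Trotter approximation\<close>

abbreviation opnorm :: "real^'n^'n \<Rightarrow> real" where
  "opnorm A \<equiv> onorm ((*v) A)"

lemma opnorm_nonneg: "0 \<le> opnorm A"
  by (intro onorm_pos_le) simp

lemma opnorm_mult: "opnorm (A ** B) \<le> opnorm A * opnorm B"
  using onorm_compose[of "(*v) A" "(*v) B"] by (simp add: o_def matrix_vector_mul_assoc)

lemma opnorm_add: "opnorm (A + B) \<le> opnorm A + opnorm B"
proof -
  have "(*v) (A + B) = (\<lambda>x. A *v x + B *v x)"
    by (simp add: fun_eq_iff matrix_vector_mult_add_rdistrib)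
  then show ?thesis
    using onorm_triangle[of "(*v) A" "(*v) B"] by simp
qed

lemma opnorm_scaleR: "opnorm (c *\<^sub>R A) = \<bar>c\<bar> * opnorm A"
proof -
  have "(*v) (c *\<^sub>R A) = (\<lambda>x. c *\<^sub>R (A *v x))"
    by (simp add: fun_eq_iff scaleR_matrix_vector_assoc)
  then show ?thesis
    using onorm_scaleR[of "(*v) A" c] by simp
qed

lemma opnorm_mat_1: "opnorm (mat 1 :: real^'n^'n) \<le> 1"
proof -
  have "(*v) (mat 1 :: real^'n^'n) = (\<lambda>x. x)" by (simp add: fun_eq_iff)
  then show ?thesis using onorm_id_le[where 'a = "real^'n"] by simp
qed

lemma opnorm_mpow_le:
  fixes A :: "real^'n^'n"
  assumes "opnorm A \<le> r"
  shows "opnorm (mpow A k) \<le> r ^ k"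
proof (induction k)
  case (Suc k)
  have "opnorm (mpow A (Suc k)) \<le> opnorm A * opnorm (mpow A k)"
    using opnorm_mult by simp
  also have "\<dots> \<le> r * r ^ k"
    using assms Suc opnorm_nonneg[of A] opnorm_nonneg[of "mpow A k"]
    by (intro mult_mono) auto
  finally show ?case by simp
next
  case 0
  show ?case using onorm_id_le[where 'a = "real^'n"] by simp
qed

text \<open>Telescoping, one factor at a time. The natural exponent of \<open>r\<close> is
  \<open>k - 1\<close>; as \<open>1 \<le> r\<close>, the exponent \<open>k\<close> is also valid and
  keeps the induction free of predecessors.\<close>

lemma opnorm_mpow_diff_le:
  assumes "opnorm A \<le> r" "opnorm B \<le> r" "1 \<le> r"
  shows "opnorm (mpow A k - mpow B k) \<le> k * r ^ k * opnorm (A - B)"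
proof (induction k)
  case 0
  then show ?case by (simp add: onorm_zero)
next
  case (Suc k)
  have "mpow A (Suc k) - mpow B (Suc k) = A ** (mpow A k - mpow B k) + (A - B) ** mpow B k"
    by (simp add: matrix_eq matrix_vector_mul_assoc[symmetric] algebra_simps)
  then have "opnorm (mpow A (Suc k) - mpow B (Suc k))
      \<le> opnorm (A ** (mpow A k - mpow B k)) + opnorm ((A - B) ** mpow B k)"
    by (simp only: opnorm_add)
  also have "\<dots> \<le> opnorm A * opnorm (mpow A k - mpow B k) + opnorm (A - B) * opnorm (mpow B k)"
    by (intro add_mono opnorm_mult)
  also have "\<dots> \<le> r * (k * r ^ k * opnorm (A - B)) + opnorm (A - B) * (r * r ^ k)"
  proof (intro add_mono mult_mono)
    have "opnorm (mpow B k) \<le> r ^ k" by (rule opnorm_mpow_le) fact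
    also have "\<dots> \<le> r * r ^ k" using assms by simp
    finally show "opnorm (mpow B k) \<le> r * r ^ k" .
  qed (use assms Suc opnorm_nonneg in auto)
  also have "\<dots> = Suc k * r ^ Suc k * opnorm (A - B)"
    by (simp add: algebra_simps)
  finally show ?case .
qed

lemma abs_trace_le_opnorm: "\<bar>trace (A :: real^'n^'n)\<bar> \<le> CARD('n) * opnorm A"
proof -
  let ?B = "range (\<lambda>i. axis i 1 :: real^'n)"
  have "\<bar>b \<bullet> (A *v b)\<bar> \<le> opnorm A" if "b \<in> ?B" for b
  proof -
    have "norm b = 1" using that by auto
    then show ?thesis
      using Cauchy_Schwarz_ineq2[of b "A *v b"] onorm[of "(*v) A" b] by simp
  qed
  then have "\<bar>trace A\<bar> \<le> (\<Sum>b\<in>?B. opnorm A)"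
    unfolding trace_orthonormal_basis[OF orthonormal_basis_axis]
    by (intro order_trans[OF sum_abs] sum_mono)
  also have "\<dots> = CARD('n) * opnorm A"
    using orthonormal_basis_card[OF orthonormal_basis_axis[where 'n = 'n]] by simp
  finally show ?thesis .
qed

definition expN :: "nat \<Rightarrow> real^'n^'n \<Rightarrow> real^'n^'n" where
  "expN N A = mpow (mat 1 + (1 / N) *\<^sub>R A) N"

lemma transpose_scaleR: "transpose (c *\<^sub>R (A :: real^'n^'m)) = c *\<^sub>R transpose A"
  by (simp add: transpose_def vec_eq_iff)

lemma transpose_plus: "transpose (A + B :: real^'n^'m) = transpose A + transpose B"
  by (simp add: transpose_def vec_eq_iff)

lemma transpose_minus: "transpose (A - B :: real^'n^'m) = transpose A - transpose B"
  by (simp add: transpose_def vec_eq_iff)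

lemma transpose_zero: "transpose (0 :: real^'n^'m) = 0"
  by (simp add: transpose_def vec_eq_iff)

lemma transpose_sum: "transpose (\<Sum>i\<in>I. f i :: real^'n^'m) = (\<Sum>i\<in>I. transpose (f i))"
  by (induction I rule: infinite_finite_induct) (simp_all add: transpose_plus transpose_zero)

text \<open>The bases of the two powers differ by \<open>A ** B\<close> over \<open>N^2\<close>;
  taking \<open>N\<close>-th powers enlarges this to order \<open>1 / N\<close>, and the trace costs
  a factor equal to the dimension.\<close>

lemma Lie_Trotter_trace:
  fixes A B :: "real^'n^'n"
  shows "(\<lambda>N. trace (expN N (A + B)) -
      trace (mpow ((mat 1 + (1 / N) *\<^sub>R A) ** (mat 1 + (1 / N) *\<^sub>R B)) N)) \<longlonglongrightarrow> 0"
proof -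
  define a b where "a = opnorm A" and "b = opnorm B"
  have ab: "0 \<le> a" "0 \<le> b" by (simp_all add: a_def b_def opnorm_nonneg)
  define E where "E = CARD('n) * (exp (a + b) * (a * b))"
  have "\<bar>trace (expN N (A + B)) -
      trace (mpow ((mat 1 + (1 / N) *\<^sub>R A) ** (mat 1 + (1 / N) *\<^sub>R B)) N)\<bar> \<le> E / N" if "N > 0" for N :: nat
  proof -
    define X Y Z where "X = mat 1 + (1 / N) *\<^sub>R A" and "Y = mat 1 + (1 / N) *\<^sub>R B"
      and "Z = mat 1 + (1 / N) *\<^sub>R (A + B)"
    \<comment> \<open>\<open>r\<close> bounds the operator norm of both bases, while
      \<open>r ^ N\<close> stays below \<open>exp (a + b)\<close> uniformly in
      \<open>N\<close>.\<close>
    define r where "r = (1 + a / N) * (1 + b / N)"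
    have r1: "1 \<le> r"
      using ab by (auto simp: r_def intro!: mult_ge1_I)
    have one: "opnorm (mat 1 + (1 / N) *\<^sub>R C) \<le> 1 + opnorm C / N" for C :: "real^'n^'n"
      using opnorm_add[of "mat 1" "(1 / N) *\<^sub>R C"] opnorm_mat_1[where 'n = 'n]
        opnorm_scaleR[of "1 / N" C] by simp
    have XY: "opnorm (X ** Y) \<le> r"
    proof -
      have "opnorm (X ** Y) \<le> opnorm X * opnorm Y" by (rule opnorm_mult)
      also have "\<dots> \<le> r"
        unfolding r_def X_def Y_def a_def b_def
        using ab by (intro mult_mono one opnorm_nonneg) (simp add: a_def)
      finally show ?thesis .
    qed
    have Z: "opnorm Z \<le> r"
    proof -
      have "opnorm Z \<le> 1 + opnorm (A + B) / N" unfolding Z_def by (rule one)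
      also have "\<dots> \<le> 1 + (a + b) / N"
        using opnorm_add[of A B] by (simp add: a_def b_def divide_right_mono)
      also have "\<dots> \<le> r"
        using ab that by (simp add: r_def field_simps)
      finally show ?thesis .
    qed
    have "Z - X ** Y = (- (1 / N\<^sup>2)) *\<^sub>R (A ** B)"
      by (simp add: X_def Y_def Z_def matrix_eq matrix_vector_mul_assoc[symmetric]
          scaleR_matrix_vector_assoc[symmetric] power2_eq_square algebra_simps
          del: scaleR_minus_left) simp
    then have diff: "opnorm (Z - X ** Y) \<le> a * b / N\<^sup>2"
      using opnorm_scaleR[of "- (1 / N\<^sup>2)" "A ** B"] opnorm_mult[of A B]
      by (simp add: a_def b_def divide_right_mono)
    have rN: "r ^ N \<le> exp (a + b)"
    proof -
      have "r \<le> exp (a / N) * exp (b / N)"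
        unfolding r_def using ab by (intro mult_mono exp_ge_add_one_self) auto
      then have "r ^ N \<le> (exp (a / N) * exp (b / N)) ^ N"
        using r1 by (intro power_mono) auto
      also have "\<dots> = exp (a + b)"
        using that by (simp add: exp_add power_mult_distrib exp_of_nat_mult[symmetric])
      finally show ?thesis .
    qed
    have "\<bar>trace (mpow Z N) - trace (mpow (X ** Y) N)\<bar> \<le> CARD('n) * opnorm (mpow Z N - mpow (X ** Y) N)"
      using abs_trace_le_opnorm[of "mpow Z N - mpow (X ** Y) N"] by (simp add: trace_sub)
    also have "\<dots> \<le> CARD('n) * (N * r ^ N * opnorm (Z - X ** Y))"
      by (intro mult_left_mono opnorm_mpow_diff_le Z XY r1) auto
    also have "\<dots> \<le> CARD('n) * (N * exp (a + b) * (a * b / N\<^sup>2))"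
      using rN diff r1 opnorm_nonneg[of "Z - X ** Y"]
      by (intro mult_left_mono mult_mono) auto
    also have "\<dots> = E / N"
      using that by (simp add: E_def power2_eq_square)
    finally show ?thesis by (simp add: X_def Y_def Z_def expN_def)
  qed
  then have "\<forall>\<^sub>F N in sequentially. norm (trace (expN N (A + B)) -
      trace (mpow ((mat 1 + (1 / N) *\<^sub>R A) ** (mat 1 + (1 / N) *\<^sub>R B)) N)) \<le> E / N"
    by (intro eventually_mono[OF eventually_gt_at_top[of 0]]) simp
  moreover have "(\<lambda>N. E / real N) \<longlonglongrightarrow> 0"
    by (rule lim_const_over_n)
  ultimately show ?thesis by (rule Lim_null_comparison)
qed

subsection \<open>The trace exponential\<close>

text \<open>The trace of the matrix exponential; the limit exists for symmetric \<open>A\<close> by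
  \<open>trace_expN_tendsto\<close>.\<close>

definition texp :: "real^'n^'n \<Rightarrow> real" where
  "texp A = lim (\<lambda>N. trace (expN N A))"

text \<open>Functional calculus for the polynomials \<open>(1 + c * t) ^ k\<close>, in terms of
  quadratic forms. The free \<open>c\<close> serves \<open>1 / N\<close> and
  \<open>- \<theta> / N\<close>, and \<open>c = k = 1\<close> recovers \<open>A\<close>
  itself.\<close>

lemma eigenbasis_inner_power:
  assumes B: "eigenbasis A B"
  shows "v \<bullet> (mpow (mat 1 + c *\<^sub>R A) k *v v) = (\<Sum>b\<in>B. (v \<bullet> b)\<^sup>2 * (1 + c * (b \<bullet> (A *v b))) ^ k)"
proof -
  have onb: "orthonormal_basis B" using B by (simp add: eigenbasis_def)
  have eig: "mpow (mat 1 + c *\<^sub>R A) k *v b = (1 + c * (b \<bullet> (A *v b))) ^ k *\<^sub>R b" if "b \<in> B" for b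
  proof (rule mpow_eigenvector)
    have "A *v b = (b \<bullet> (A *v b)) *\<^sub>R b" using B that by (simp add: eigenbasis_def)
    then have "c *\<^sub>R (A *v b) = (c * (b \<bullet> (A *v b))) *\<^sub>R b"
      by (metis scaleR_scaleR)
    then show "(mat 1 + c *\<^sub>R A) *v b = (1 + c * (b \<bullet> (A *v b))) *\<^sub>R b"
      by (simp add: matrix_vector_mult_add_rdistrib scaleR_matrix_vector_assoc[symmetric] scaleR_left_distrib)
  qed
  have "mpow (mat 1 + c *\<^sub>R A) k *v v = mpow (mat 1 + c *\<^sub>R A) k *v (\<Sum>b\<in>B. (v \<bullet> b) *\<^sub>R b)"
    by (simp add: orthonormal_basis_representation[OF onb])
  also have "\<dots> = (\<Sum>b\<in>B. (v \<bullet> b) *\<^sub>R (mpow (mat 1 + c *\<^sub>R A) k *v b))"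
    by (simp add: linear_sum[OF matrix_vector_mul_linear] matrix_vector_mult_scaleR)
  also have "\<dots> = (\<Sum>b\<in>B. (v \<bullet> b) *\<^sub>R ((1 + c * (b \<bullet> (A *v b))) ^ k *\<^sub>R b))"
    by (intro sum.cong refl) (simp add: eig)
  finally show ?thesis
    by (simp add: inner_sum_right power2_eq_square mult_ac)
qed

lemma eigenbasis_inner:
  assumes B: "eigenbasis A B"
  shows "v \<bullet> (A *v v) = (\<Sum>b\<in>B. (v \<bullet> b)\<^sup>2 * (b \<bullet> (A *v b)))"
proof -
  have onb: "orthonormal_basis B" using B by (simp add: eigenbasis_def)
  have "v \<bullet> v + v \<bullet> (A *v v) = (\<Sum>b\<in>B. (v \<bullet> b)\<^sup>2) + (\<Sum>b\<in>B. (v \<bullet> b)\<^sup>2 * (b \<bullet> (A *v b)))"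
    using eigenbasis_inner_power[OF B, of v 1 1]
    by (simp add: matrix_vector_mult_add_rdistrib inner_add_right distrib_left sum.distrib)
  then show ?thesis
    using orthonormal_basis_norm_sum[OF onb, of v] by (simp add: power2_norm_eq_inner)
qed

lemma trace_expN_tendsto_eigenbasis:
  assumes B: "eigenbasis A B"
  shows "(\<lambda>N. trace (expN N A)) \<longlonglongrightarrow> (\<Sum>b\<in>B. exp (b \<bullet> (A *v b)))"
proof -
  have onb: "orthonormal_basis B" using B by (simp add: eigenbasis_def)
  have fin: "finite B" using onb by (rule orthonormal_basis_finite)
  have "b \<bullet> (expN N A *v b) = (1 + (b \<bullet> (A *v b)) / N) ^ N" if "b \<in> B" for b N
  proof -
    have "(b \<bullet> c)\<^sup>2 = (if c = b then 1 else 0)" if "c \<in> B" for c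
      using onb \<open>b \<in> B\<close> that
      by (auto simp: orthonormal_basis_def pairwise_def orthogonal_def power2_norm_eq_inner[symmetric])
    then have "(\<Sum>c\<in>B. (b \<bullet> c)\<^sup>2 * (1 + (1 / N) * (c \<bullet> (A *v c))) ^ N)
        = (\<Sum>c\<in>B. if c = b then (1 + (1 / N) * (c \<bullet> (A *v c))) ^ N else 0)"
      by (intro sum.cong) auto
    then show ?thesis
      using that fin by (simp add: expN_def eigenbasis_inner_power[OF B])
  qed
  then have "trace (expN N A) = (\<Sum>b\<in>B. (1 + (b \<bullet> (A *v b)) / N) ^ N)" for N
    by (simp add: trace_orthonormal_basis[OF onb])
  then show ?thesis
    by (simp add: tendsto_sum tendsto_exp_limit_sequentially)
qed

lemma texp_eigenbasis: "eigenbasis A B \<Longrightarrow> texp A = (\<Sum>b\<in>B. exp (b \<bullet> (A *v b)))"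
  unfolding texp_def by (rule limI) (rule trace_expN_tendsto_eigenbasis)

lemma trace_expN_tendsto: "transpose A = A \<Longrightarrow> (\<lambda>N. trace (expN N A)) \<longlonglongrightarrow> texp A"
  using eigenbasis_exists trace_expN_tendsto_eigenbasis texp_eigenbasis by metis

lemma texp_zero: "texp (0 :: real^'n^'n) = CARD('n)"
proof -
  have "eigenbasis (0 :: real^'n^'n) (range (\<lambda>i. axis i 1))"
    using orthonormal_basis_axis by (simp add: eigenbasis_def)
  from texp_eigenbasis[OF this] show ?thesis
    using orthonormal_basis_card[OF orthonormal_basis_axis[where 'n = 'n]] by simp
qed

text \<open>Jensen: the squares \<open>(v \<bullet> b)\<^sup>2\<close> are weights with sum 1, and
  the form at \<open>v\<close> is the weighted mean of the eigenvalues.\<close>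

lemma exp_inner_le_eigenbasis:
  assumes B: "eigenbasis A B" and v: "norm v = 1"
  shows "exp (v \<bullet> (A *v v)) \<le> (\<Sum>b\<in>B. (v \<bullet> b)\<^sup>2 * exp (b \<bullet> (A *v b)))"
proof -
  have onb: "orthonormal_basis B" using B by (simp add: eigenbasis_def)
  have one: "(\<Sum>b\<in>B. (v \<bullet> b)\<^sup>2) = 1"
    using orthonormal_basis_norm_sum[OF onb, of v] v by simp
  then have "B \<noteq> {}" by auto
  then show ?thesis
    using convex_on_sum[OF orthonormal_basis_finite[OF onb] _ exp_convex one, of "\<lambda>b. b \<bullet> (A *v b)"]
    by (simp add: eigenbasis_inner[OF B, of v])
qed

text \<open>Makes one bad direction visible in the trace: a small form of the sampled sum at a
  single unit vector already makes \<open>texp\<close> of its negative multiple large.\<close>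

lemma exp_inner_le_texp:
  assumes "transpose A = A" "norm v = 1"
  shows "exp (v \<bullet> (A *v v)) \<le> texp A"
proof -
  obtain B where B: "eigenbasis A B" using eigenbasis_exists assms(1) by blast
  have "(v \<bullet> b)\<^sup>2 \<le> 1" if "b \<in> B" for b
    using Cauchy_Schwarz_ineq2[of v b] assms(2) B that
    by (auto simp: eigenbasis_def orthonormal_basis_def abs_square_le_1)
  then have "(\<Sum>b\<in>B. (v \<bullet> b)\<^sup>2 * exp (b \<bullet> (A *v b))) \<le> (\<Sum>b\<in>B. exp (b \<bullet> (A *v b)))"
    by (intro sum_mono) (simp add: mult_left_le_one_le)
  then show ?thesis
    using exp_inner_le_eigenbasis[OF B assms(2)] texp_eigenbasis[OF B] by linarith
qed

lemma texp_nonneg: "transpose A = A \<Longrightarrow> 0 \<le> texp (A :: real^'n^'n)"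
  using exp_inner_le_texp[of A "axis undefined 1"] by (metis exp_ge_zero norm_axis_1 order_trans)

text \<open>Peierls' inequality. After Jensen for each \<open>c\<close>, the weights
  \<open>(c \<bullet> b)\<^sup>2\<close> sum to 1 over \<open>c\<close> for each fixed
  \<open>b\<close>, because both bases are orthonormal.\<close>

lemma sum_exp_inner_le_texp:
  assumes "transpose A = A" and C: "orthonormal_basis C"
  shows "(\<Sum>c\<in>C. exp (c \<bullet> (A *v c))) \<le> texp A"
proof -
  obtain B where B: "eigenbasis A B" using eigenbasis_exists assms(1) by blast
  have "(\<Sum>c\<in>C. exp (c \<bullet> (A *v c))) \<le> (\<Sum>c\<in>C. \<Sum>b\<in>B. (c \<bullet> b)\<^sup>2 * exp (b \<bullet> (A *v b)))"
    by (intro sum_mono exp_inner_le_eigenbasis[OF B] orthonormal_basis_norm[OF C])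
  also have "\<dots> = (\<Sum>b\<in>B. (\<Sum>c\<in>C. (b \<bullet> c)\<^sup>2) * exp (b \<bullet> (A *v b)))"
    by (subst sum.swap) (simp add: sum_distrib_right inner_commute)
  also have "\<dots> = (\<Sum>b\<in>B. exp (b \<bullet> (A *v b)))"
    using B by (intro sum.cong) (auto simp: orthonormal_basis_norm_sum[OF C] eigenbasis_def orthonormal_basis_def)
  finally show ?thesis by (simp add: texp_eigenbasis[OF B])
qed

text \<open>In an eigenbasis of the average the left side is a sum of scalar exponentials, where
  convexity of \<open>exp\<close> applies; Peierls' inequality then returns from this basis to each
  \<open>A i\<close>.\<close>

lemma texp_convex_sum:
  fixes A :: "'i \<Rightarrow> real^'n^'n"
  assumes fin: "finite I" and w: "\<And>i. i \<in> I \<Longrightarrow> 0 \<le> w i" "sum w I = 1"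
    and sym: "\<And>i. i \<in> I \<Longrightarrow> transpose (A i) = A i"
  shows "texp (\<Sum>i\<in>I. w i *\<^sub>R A i) \<le> (\<Sum>i\<in>I. w i * texp (A i))"
proof -
  define T where "T = (\<Sum>i\<in>I. w i *\<^sub>R A i)"
  have "transpose T = T"
    unfolding T_def transpose_sum by (intro sum.cong refl) (simp add: transpose_scaleR sym)
  then obtain C where C: "eigenbasis T C" using eigenbasis_exists by blast
  then have onb: "orthonormal_basis C" by (simp add: eigenbasis_def)
  have "I \<noteq> {}" using w by auto
  have Tv: "T *v c = (\<Sum>i\<in>I. w i *\<^sub>R (A i *v c))" for c
    unfolding T_def using fin
    by (induction I rule: finite_induct)
      (simp_all add: matrix_vector_mult_add_rdistrib scaleR_matrix_vector_assoc)
  have "texp T = (\<Sum>c\<in>C. exp (\<Sum>i\<in>I. w i *\<^sub>R (c \<bullet> (A i *v c))))"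
    by (simp add: texp_eigenbasis[OF C] Tv inner_sum_right)
  also have "\<dots> \<le> (\<Sum>c\<in>C. \<Sum>i\<in>I. w i * exp (c \<bullet> (A i *v c)))"
    by (intro sum_mono convex_on_sum[OF fin \<open>I \<noteq> {}\<close> exp_convex w(2) w(1)]) auto
  also have "\<dots> = (\<Sum>i\<in>I. w i * (\<Sum>c\<in>C. exp (c \<bullet> (A i *v c))))"
    by (subst sum.swap) (simp add: sum_distrib_left)
  also have "\<dots> \<le> (\<Sum>i\<in>I. w i * texp (A i))"
    by (intro sum_mono mult_left_mono sum_exp_inner_le_texp sym onb w(1))
  finally show ?thesis by (simp add: T_def)
qed

section \<open>The trace exponential after one random draw\<close>

lemma trace_sandwich:
  fixes Q M :: "real^'n^'n"
  assumes "transpose Q = Q" and B: "orthonormal_basis B"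
  shows "trace ((Q ** Q) ** M) = (\<Sum>b\<in>B. (Q *v b) \<bullet> (M *v (Q *v b)))"
proof -
  have "trace ((Q ** Q) ** M) = trace (Q ** (M ** Q))"
    using trace_mul_sym[of Q "Q ** M"] by (simp add: matrix_mul_assoc)
  then show ?thesis
    by (simp add: trace_orthonormal_basis[OF B] matrix_vector_mul_assoc[symmetric] symmetric_inner[OF assms(1)])
qed

text \<open>On \<open>[0, R]\<close>, which contains the spectrum of \<open>X\<close>, the function
  \<open>(1 - \<theta> * t / N) ^ N\<close> lies below its chord. Convexity comes from
  \<open>N\<close> being even.\<close>

lemma inner_expN_le:
  fixes X :: "real^'n^'n"
  assumes "transpose X = X" and X: "\<And>v. 0 \<le> v \<bullet> (X *v v)" "\<And>v. v \<bullet> (X *v v) \<le> R * (v \<bullet> v)"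
    and "0 < R" "even N"
  shows "v \<bullet> (expN N (- \<theta> *\<^sub>R X) *v v)
    \<le> v \<bullet> v - (1 - (1 + (- \<theta> * R) / N) ^ N) / R * (v \<bullet> (X *v v))"
proof -
  obtain B where B: "eigenbasis X B" using eigenbasis_exists assms(1) by blast
  then have onb: "orthonormal_basis B" by (simp add: eigenbasis_def)
  define c where "c = (1 - (1 + (- \<theta> * R) / N) ^ N) / R"
  have chord: "(1 + (- (\<theta> / N)) * l) ^ N \<le> 1 - c * l" if "0 \<le> l" "l \<le> R" for l
  proof -
    \<comment> \<open>The eigenvalue \<open>l\<close> is a convex combination of \<open>0\<close>
      and \<open>R\<close>, whose images under the affine map are the points \<open>1\<close> and
      \<open>1 - \<theta> * R / N\<close>.\<close>
    have "(\<lambda>x. x ^ N) ((1 - l / R) *\<^sub>R 1 + (l / R) *\<^sub>R (1 + (- \<theta> * R) / N))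
        \<le> (1 - l / R) * 1 ^ N + (l / R) * (1 + (- \<theta> * R) / N) ^ N"
      using that \<open>0 < R\<close> by (intro convex_onD[OF convex_power_even[OF \<open>even N\<close>]]) auto
    also have "(1 - l / R) *\<^sub>R 1 + (l / R) *\<^sub>R (1 + (- \<theta> * R) / N) = 1 + (- (\<theta> / N)) * l"
      using \<open>0 < R\<close> by (simp add: field_simps)
    also have "(1 - l / R) * 1 ^ N + (l / R) * (1 + (- \<theta> * R) / N) ^ N = 1 - c * l"
      using \<open>0 < R\<close> by (simp add: c_def field_simps)
    finally show ?thesis by simp
  qed
  have "v \<bullet> (expN N (- \<theta> *\<^sub>R X) *v v) = (\<Sum>b\<in>B. (v \<bullet> b)\<^sup>2 * (1 + (- (\<theta> / N)) * (b \<bullet> (X *v b))) ^ N)"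
    using eigenbasis_inner_power[OF B, of v "- (\<theta> / N)" N] by (simp add: expN_def)
  also have "\<dots> \<le> (\<Sum>b\<in>B. (v \<bullet> b)\<^sup>2 * (1 - c * (b \<bullet> (X *v b))))"
  proof (intro sum_mono mult_left_mono chord)
    fix b assume "b \<in> B"
    then have "b \<bullet> b = 1"
      using onb by (simp add: orthonormal_basis_def power2_norm_eq_inner[symmetric])
    then show "b \<bullet> (X *v b) \<le> R" using X(2)[of b] by simp
  qed (auto simp: X)
  also have "\<dots> = (\<Sum>b\<in>B. (v \<bullet> b)\<^sup>2) - c * (\<Sum>b\<in>B. (v \<bullet> b)\<^sup>2 * (b \<bullet> (X *v b)))"
    by (simp add: right_diff_distrib sum_subtractf sum_distrib_left mult_ac)
  also have "\<dots> = v \<bullet> v - c * (v \<bullet> (X *v v))"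
    by (simp add: orthonormal_basis_norm_sum[OF onb] eigenbasis_inner[OF B, of v] power2_norm_eq_inner)
  finally show ?thesis by (simp add: c_def)
qed

text \<open>Golden--Thompson separates each draw from \<open>A\<close>. The draws are then added up
  as quadratic forms before the trace is taken, so the hypothesis on their mean can enter.\<close>

lemma sum_trace_le:
  fixes A :: "real^'n^'n" and X :: "'i \<Rightarrow> real^'n^'n"
  assumes A: "transpose A = A"
    and X: "\<And>i. i \<in> I \<Longrightarrow> transpose (X i) = X i" "\<And>i v. i \<in> I \<Longrightarrow> 0 \<le> v \<bullet> (X i *v v)"
      "\<And>i v. i \<in> I \<Longrightarrow> v \<bullet> (X i *v v) \<le> R * (v \<bullet> v)"
    and mean: "\<And>v. \<mu> * (v \<bullet> v) * card I \<le> (\<Sum>i\<in>I. v \<bullet> (X i *v v))"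
    and "0 < R" "0 \<le> \<theta>" and N: "N = 2 ^ Suc k" "\<theta> * R \<le> N"
  shows "(\<Sum>i\<in>I. trace (mpow ((mat 1 + (1 / N) *\<^sub>R A) ** (mat 1 + (1 / N) *\<^sub>R (- \<theta> *\<^sub>R X i))) N))
    \<le> card I * (1 - (1 - (1 + (- \<theta> * R) / N) ^ N) / R * \<mu>) * trace (expN N A)"
proof -
  let ?B = "range (\<lambda>i. axis i 1 :: real^'n)"
  define c where "c = (1 - (1 + (- \<theta> * R) / N) ^ N) / R"
  \<comment> \<open>Half of the \<open>N = 2 ^ Suc k\<close> factors: a symmetric square root of
    \<open>expN N A\<close>.\<close>
  define Q where "Q = mpow (mat 1 + (1 / N) *\<^sub>R A) (2 ^ k)"
  have N0: "0 < N" "even N" using N(1) by auto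
  \<comment> \<open>\<open>\<theta> * R \<le> N\<close> keeps the base in \<open>[0, 1]\<close>; so
    \<open>c\<close> is nonnegative and a lower bound on the mean gives an upper bound on the
    sum.\<close>
  have "(1 + (- \<theta> * R) / N) ^ N \<le> 1 ^ N"
    using N(2) N0 \<open>0 < R\<close> \<open>0 \<le> \<theta>\<close> by (intro power_mono) (auto simp: field_simps)
  then have c0: "0 \<le> c" using \<open>0 < R\<close> by (simp add: c_def)
  have symX: "transpose (mat 1 + a *\<^sub>R C) = mat 1 + a *\<^sub>R C" if "transpose C = C" for a and C :: "real^'n^'n"
    using that by (simp add: transpose_plus transpose_scaleR transpose_mat)
  have Q: "transpose Q = Q" unfolding Q_def by (intro transpose_mpow symX A)
  have half: "2 ^ k + 2 ^ k = N" using N(1) by simp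
  have QQ: "expN N A = Q ** Q"
    unfolding Q_def expN_def mpow_add[symmetric] half by (rule refl)
  have form: "(\<Sum>i\<in>I. v \<bullet> (expN N (- \<theta> *\<^sub>R X i) *v v)) \<le> card I * (1 - c * \<mu>) * (v \<bullet> v)" for v
  proof -
    have "(\<Sum>i\<in>I. v \<bullet> (expN N (- \<theta> *\<^sub>R X i) *v v)) \<le> (\<Sum>i\<in>I. v \<bullet> v - c * (v \<bullet> (X i *v v)))"
      unfolding c_def by (intro sum_mono inner_expN_le X \<open>0 < R\<close> N0)
    also have "\<dots> = card I * (v \<bullet> v) - c * (\<Sum>i\<in>I. v \<bullet> (X i *v v))"
      by (simp add: sum_subtractf sum_distrib_left)
    also have "\<dots> \<le> card I * (v \<bullet> v) - c * (\<mu> * (v \<bullet> v) * card I)"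
      using mult_left_mono[OF mean[of v] c0] by simp
    finally show ?thesis by (simp add: algebra_simps)
  qed
  have "(\<Sum>i\<in>I. trace (mpow ((mat 1 + (1 / N) *\<^sub>R A) ** (mat 1 + (1 / N) *\<^sub>R (- \<theta> *\<^sub>R X i))) N))
      \<le> (\<Sum>i\<in>I. trace (expN N A ** expN N (- \<theta> *\<^sub>R X i)))"
    unfolding expN_def N(1)
    by (intro sum_mono trace_mpow_mult_le symX A) (simp only: transpose_scaleR X)
  \<comment> \<open>With one \<open>Q\<close> on each side, every trace is a sum of values of a
    quadratic form at the vectors \<open>Q *v b\<close>, to which \<open>form\<close>
    applies.\<close>
  also have "\<dots> = (\<Sum>b\<in>?B. \<Sum>i\<in>I. (Q *v b) \<bullet> (expN N (- \<theta> *\<^sub>R X i) *v (Q *v b)))"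
    unfolding QQ trace_sandwich[OF Q orthonormal_basis_axis] by (rule sum.swap)
  also have "\<dots> \<le> (\<Sum>b\<in>?B. card I * (1 - c * \<mu>) * ((Q *v b) \<bullet> (Q *v b)))"
    by (intro sum_mono form)
  also have "\<dots> = card I * (1 - c * \<mu>) * trace (expN N A)"
    using trace_sandwich[OF Q orthonormal_basis_axis, of "mat 1"] by (simp add: QQ sum_distrib_left)
  finally show ?thesis by (simp add: c_def)
qed

text \<open>The limit of \<open>sum_trace_le\<close> along powers of two, the exponents for which
  the Golden--Thompson inequality was proved.\<close>

lemma sum_texp_le:
  fixes A :: "real^'n^'n" and X :: "'i \<Rightarrow> real^'n^'n"
  assumes A: "transpose A = A"
    and X: "\<And>i. i \<in> I \<Longrightarrow> transpose (X i) = X i" "\<And>i v. i \<in> I \<Longrightarrow> 0 \<le> v \<bullet> (X i *v v)"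
      "\<And>i v. i \<in> I \<Longrightarrow> v \<bullet> (X i *v v) \<le> R * (v \<bullet> v)"
    and mean: "\<And>v. \<mu> * (v \<bullet> v) * card I \<le> (\<Sum>i\<in>I. v \<bullet> (X i *v v))"
    and "0 < R" "0 \<le> \<theta>"
  shows "(\<Sum>i\<in>I. texp (A - \<theta> *\<^sub>R X i)) \<le> card I * (1 - (1 - exp (- \<theta> * R)) / R * \<mu>) * texp A"
proof -
  define N where "N k = (2::nat) ^ Suc k" for k
  have sub: "filterlim N at_top sequentially"
    unfolding N_def by (intro filterlim_subseq) (simp add: strict_mono_Suc_iff)
  define D where "D i M = trace (mpow ((mat 1 + (1 / real M) *\<^sub>R A) ** (mat 1 + (1 / real M) *\<^sub>R (- \<theta> *\<^sub>R X i))) M)" for i M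
  have "(\<lambda>k. \<Sum>i\<in>I. trace (expN (N k) (A + - \<theta> *\<^sub>R X i))) \<longlonglongrightarrow> (\<Sum>i\<in>I. texp (A + - \<theta> *\<^sub>R X i))"
    by (intro tendsto_sum filterlim_compose[OF trace_expN_tendsto sub])
      (simp add: transpose_minus transpose_scaleR A X)
  \<comment> \<open>The majorant splits into the Lie--Trotter error, which vanishes, and the bound
    on the products, whose limit is the claim.\<close>
  moreover have "(\<lambda>k. (\<Sum>i\<in>I. trace (expN (N k) (A + - \<theta> *\<^sub>R X i)) - D i (N k))
      + card I * (1 - (1 - (1 + (- \<theta> * R) / N k) ^ N k) / R * \<mu>) * trace (expN (N k) A))
     \<longlonglongrightarrow> (\<Sum>i\<in>I. 0) + card I * (1 - (1 - exp (- \<theta> * R)) / R * \<mu>) * texp A"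
    using \<open>0 < R\<close> unfolding D_def
    by (intro tendsto_intros filterlim_compose[OF Lie_Trotter_trace sub]
        filterlim_compose[OF trace_expN_tendsto[OF A] sub]
        filterlim_compose[OF tendsto_exp_limit_sequentially sub]) auto
  moreover have "\<exists>K. \<forall>k\<ge>K. (\<Sum>i\<in>I. trace (expN (N k) (A + - \<theta> *\<^sub>R X i))) \<le>
      (\<Sum>i\<in>I. trace (expN (N k) (A + - \<theta> *\<^sub>R X i)) - D i (N k))
      + card I * (1 - (1 - (1 + (- \<theta> * R) / N k) ^ N k) / R * \<mu>) * trace (expN (N k) A)"
  proof -
    have "\<forall>\<^sub>F k in sequentially. nat \<lceil>\<theta> * R\<rceil> \<le> N k"
      using sub unfolding filterlim_at_top by blast
    then have "\<forall>\<^sub>F k in sequentially. (\<Sum>i\<in>I. trace (expN (N k) (A + - \<theta> *\<^sub>R X i))) \<le>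
      (\<Sum>i\<in>I. trace (expN (N k) (A + - \<theta> *\<^sub>R X i)) - D i (N k))
      + card I * (1 - (1 - (1 + (- \<theta> * R) / N k) ^ N k) / R * \<mu>) * trace (expN (N k) A)"
    proof eventually_elim
      case (elim k)
      then have "\<theta> * R \<le> N k" by linarith
      from sum_trace_le[OF A X mean \<open>0 < R\<close> \<open>0 \<le> \<theta>\<close> N_def this]
      show ?case unfolding D_def[symmetric] by (simp add: sum_subtractf)
    qed
    then show ?thesis by (simp add: eventually_sequentially)
  qed
  ultimately show ?thesis
    using LIMSEQ_le by fastforce
qed

subsection \<open>The smallest eigenvalue of a sum of sampled matrices\<close>

lemma finite_set_replicate_pmf: "finite (set_pmf p) \<Longrightarrow> finite (set_pmf (replicate_pmf s p))"
  by (simp add: set_replicate_pmf lists_eq_set finite_lists_length_eq)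

lemma expectation_replicate_pmf_Suc:
  fixes h :: "'a list \<Rightarrow> real"
  assumes "finite I" "I \<noteq> {}"
  shows "measure_pmf.expectation (replicate_pmf (Suc s) (pmf_of_set I)) h
    = (\<Sum>i\<in>I. measure_pmf.expectation (replicate_pmf s (pmf_of_set I)) (\<lambda>xs. h (i # xs))) / card I"
proof -
  have fin: "finite (set_pmf (replicate_pmf s (pmf_of_set I)))"
    using assms by (intro finite_set_replicate_pmf) simp
  have "replicate_pmf (Suc s) (pmf_of_set I)
      = pmf_of_set I \<bind> (\<lambda>i. map_pmf ((#) i) (replicate_pmf s (pmf_of_set I)))"
    by (simp add: map_pmf_def)
  then show ?thesis
    using assms fin
    by (simp add: pmf_expectation_bind_pmf_of_set sum_divide_distrib divide_inverse mult.commute sum_distrib_left)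
qed

text \<open>Markov's inequality relative to the support: \<open>texp\<close> is known to be
  nonnegative for symmetric arguments, which draws from the population guarantee.\<close>

lemma prob_le_expectation_div:
  fixes h :: "'a \<Rightarrow> real"
  assumes fin: "finite (set_pmf p)" and "0 < a"
    and "\<And>x. x \<in> set_pmf p \<Longrightarrow> 0 \<le> h x" "\<And>x. x \<in> E \<Longrightarrow> x \<in> set_pmf p \<Longrightarrow> a \<le> h x"
  shows "measure_pmf.prob p E \<le> measure_pmf.expectation p h / a"
proof -
  have "measure_pmf.prob p E = measure_pmf.expectation p (indicator E)"
    by simp
  also have "\<dots> \<le> measure_pmf.expectation p (\<lambda>x. h x / a)"
    using assms by (intro integral_mono_AE integrable_measure_pmf_finite)
      (auto simp: AE_measure_pmf_iff indicator_def)
  finally show ?thesis by simp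
qed

text \<open>Double counting: adding an outside element to \<open>S\<close> and removing an element
  from \<open>T\<close> are inverse to each other on such pairs.\<close>

lemma sum_subsets_insert:
  fixes u :: "'a set \<Rightarrow> 'a \<Rightarrow> real"
  assumes "finite I"
  shows "(\<Sum>S | S \<subseteq> I \<and> card S = k. \<Sum>i\<in>I - S. u S i)
       = (\<Sum>T | T \<subseteq> I \<and> card T = Suc k. \<Sum>i\<in>T. u (T - {i}) i)"
proof -
  let ?A = "Sigma {S. S \<subseteq> I \<and> card S = k} (\<lambda>S. I - S)"
  let ?B = "Sigma {T. T \<subseteq> I \<and> card T = Suc k} (\<lambda>T. T)"
  have fin: "finite {S. S \<subseteq> I \<and> card S = m}" for m
    using assms by simp
  have sub: "finite S" if "S \<subseteq> I" for S
    using that assms by (rule finite_subset)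
  have "(\<Sum>S | S \<subseteq> I \<and> card S = k. \<Sum>i\<in>I - S. u S i) = (\<Sum>(S, i)\<in>?A. u S i)"
    using assms fin by (intro sum.Sigma) auto
  also have "\<dots> = (\<Sum>(T, i)\<in>?B. u (T - {i}) i)"
    by (rule sum.reindex_bij_witness[where i = "\<lambda>(T, i). (T - {i}, i)" and j = "\<lambda>(S, i). (insert i S, i)"])
      (auto simp: sub card_Diff_singleton insert_absorb)
  also have "\<dots> = (\<Sum>T | T \<subseteq> I \<and> card T = Suc k. \<Sum>i\<in>T. u (T - {i}) i)"
    using sub fin by (intro sum.Sigma[symmetric]) auto
  finally show ?thesis .
qed

section \<open>Matrix Chernoff bound for populations of positive semidefinite matrices\<close>

locale psd_population =
  fixes X :: "'i \<Rightarrow> real^'n^'n" and I :: "'i set" and R \<mu> :: real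
  assumes finite_I: "finite I" and I_nonempty: "I \<noteq> {}"
    and symmetric_X: "\<And>i. i \<in> I \<Longrightarrow> transpose (X i) = X i"
    and nonneg_X: "\<And>i v. i \<in> I \<Longrightarrow> 0 \<le> v \<bullet> (X i *v v)"
    and bound_X: "\<And>i v. i \<in> I \<Longrightarrow> v \<bullet> (X i *v v) \<le> R * (v \<bullet> v)"
    and mean_X: "\<And>v. \<mu> * (v \<bullet> v) * card I \<le> (\<Sum>i\<in>I. v \<bullet> (X i *v v))"
    and R_pos: "0 < R"
begin

text \<open>The value at \<open>\<mu>\<close> of the chord of \<open>exp (- \<theta> * t)\<close>
  over \<open>[0, R]\<close>; one independent draw multiplies the expected trace exponential by at
  most this factor.\<close>

definition rate :: "real \<Rightarrow> real" where
  "rate \<theta> = 1 - (1 - exp (- \<theta> * R)) / R * \<mu>"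

lemma texp_step:
  assumes "transpose A = A" "0 \<le> \<theta>"
  shows "(\<Sum>i\<in>I. texp (A - \<theta> *\<^sub>R X i)) \<le> card I * rate \<theta> * texp A"
  unfolding rate_def
  using assms symmetric_X nonneg_X bound_X mean_X R_pos by (intro sum_texp_le) auto

text \<open>Read off from one draw at \<open>A = 0\<close>: the left side of
  \<open>texp_step\<close> is a sum of nonnegative terms, and \<open>texp 0\<close> is the positive
  dimension.\<close>

lemma rate_nonneg:
  assumes "0 \<le> \<theta>"
  shows "0 \<le> rate \<theta>"
proof -
  have "0 \<le> (\<Sum>i\<in>I. texp (0 - \<theta> *\<^sub>R X i))"
    by (intro sum_nonneg texp_nonneg) (simp only: transpose_minus transpose_scaleR transpose_zero symmetric_X)
  also have "\<dots> \<le> card I * rate \<theta> * texp (0 :: real^'n^'n)"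
    by (intro texp_step assms transpose_zero)
  finally show ?thesis
    using finite_I I_nonempty by (simp add: texp_zero zero_le_mult_iff card_gt_0_iff)
qed

text \<open>The matrix \<open>A\<close> is general because the induction absorbs the first draw into
  it.\<close>

lemma expectation_texp_with_replacement:
  assumes "0 \<le> \<theta>" "transpose A = A"
  shows "measure_pmf.expectation (replicate_pmf s (pmf_of_set I)) (\<lambda>xs. texp (A - \<theta> *\<^sub>R (\<Sum>i\<leftarrow>xs. X i)))
    \<le> rate \<theta> ^ s * texp A"
  using assms(2)
proof (induction s arbitrary: A)
  case 0
  then show ?case by simp
next
  case (Suc s)
  have "measure_pmf.expectation (replicate_pmf (Suc s) (pmf_of_set I)) (\<lambda>xs. texp (A - \<theta> *\<^sub>R (\<Sum>i\<leftarrow>xs. X i)))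
      = (\<Sum>i\<in>I. measure_pmf.expectation (replicate_pmf s (pmf_of_set I))
           (\<lambda>xs. texp ((A - \<theta> *\<^sub>R X i) - \<theta> *\<^sub>R (\<Sum>i\<leftarrow>xs. X i)))) / card I"
    unfolding expectation_replicate_pmf_Suc[OF finite_I I_nonempty]
    by (simp add: scaleR_right_distrib diff_diff_eq)
  also have "\<dots> \<le> (\<Sum>i\<in>I. rate \<theta> ^ s * texp (A - \<theta> *\<^sub>R X i)) / card I"
    using Suc.prems symmetric_X
    by (intro divide_right_mono sum_mono Suc.IH) (auto simp: transpose_minus transpose_scaleR)
  also have "\<dots> = rate \<theta> ^ s * (\<Sum>i\<in>I. texp (A - \<theta> *\<^sub>R X i)) / card I"
    by (simp add: sum_distrib_left)
  also have "\<dots> \<le> rate \<theta> ^ s * (card I * rate \<theta> * texp A) / card I"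
    using Suc.prems assms(1)
    by (intro divide_right_mono mult_left_mono texp_step zero_le_power rate_nonneg) auto
  also have "\<dots> = rate \<theta> ^ Suc s * texp A"
    using finite_I I_nonempty by simp
  finally show ?case .
qed

text \<open>Replacing one element \<open>i\<close> of \<open>T\<close> by another element \<open>j\<close> of \<open>T\<close> does not change the sum
  on average over \<open>(i, j)\<close>; this is Hoeffding's comparison of sampling without replacement to
  sampling with replacement, for one draw.\<close>

lemma texp_exchange:
  assumes T: "T \<subseteq> I" "card T = Suc k"
  shows "Suc k * k * texp (- \<theta> *\<^sub>R sum X T)
    \<le> (\<Sum>i\<in>T. \<Sum>j\<in>T - {i}. texp (- \<theta> *\<^sub>R (sum X (T - {i}) + X j)))"
proof (cases "k = 0")
  case True
  then obtain i where "T = {i}" using T by (auto simp: card_1_singleton_iff)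
  with True show ?thesis by simp
next
  case False
  define P where "P = Sigma T (\<lambda>i. T - {i})"
  have finT: "finite T" using T(2) card.infinite by force
  have cardT: "card (T - {i}) = k" if "i \<in> T" for i using that T finT by simp
  have finP: "finite P" using finT by (auto simp: P_def)
  have cardP: "card P = Suc k * k"
    unfolding P_def using finT by (subst card_SigmaI) (auto simp: cardT T)
  define w where "w = 1 / real (Suc k * k)"
  define Z where "Z i j = sum X T - X i + X j" for i j
  have "(\<Sum>(i, j)\<in>P. X i) = (\<Sum>i\<in>T. \<Sum>j\<in>T - {i}. X i)"
    unfolding P_def using finT by (subst sum.Sigma) auto
  also have "\<dots> = real k *\<^sub>R sum X T"
    unfolding scaleR_sum_right
    by (intro sum.cong refl) (simp add: cardT T(2) sum_constant_scaleR del: sum_constant)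
  finally have 1: "(\<Sum>(i, j)\<in>P. X i) = real k *\<^sub>R sum X T" .
  \<comment> \<open>Swapping coordinates maps \<open>P\<close> to itself, so the removed and the
    inserted matrices cancel in the sum of all \<open>Z i j\<close>; Jensen with the uniform weight
    \<open>w\<close> then applies.\<close>
  have "(\<Sum>(i, j)\<in>P. X j) = (\<Sum>(i, j)\<in>P. X i)"
    by (rule sum.reindex_bij_witness[where i = "\<lambda>(i, j). (j, i)" and j = "\<lambda>(i, j). (j, i)"])
      (auto simp: P_def)
  then have "(\<Sum>(i, j)\<in>P. Z i j) = real (card P) *\<^sub>R sum X T"
    by (simp add: Z_def case_prod_unfold sum.distrib sum_subtractf sum_constant_scaleR del: sum_constant)
  moreover have w1: "w * real (card P) = 1"
    unfolding w_def cardP using False by (simp del: of_nat_mult mult_Suc)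
  ultimately have wP: "w *\<^sub>R (\<Sum>(i, j)\<in>P. Z i j) = sum X T"
    by simp
  have mean: "(\<Sum>p\<in>P. w *\<^sub>R (- \<theta> *\<^sub>R (case p of (i, j) \<Rightarrow> Z i j))) = - \<theta> *\<^sub>R sum X T"
    using wP by (simp only: scaleR_sum_right[symmetric] scaleR_left_commute[of w])
  have "texp (\<Sum>p\<in>P. w *\<^sub>R (- \<theta> *\<^sub>R (case p of (i, j) \<Rightarrow> Z i j)))
      \<le> (\<Sum>p\<in>P. w * texp (- \<theta> *\<^sub>R (case p of (i, j) \<Rightarrow> Z i j)))"
  proof (rule texp_convex_sum[OF finP])
    show "(\<Sum>p\<in>P. w) = 1" using w1 by (simp add: mult.commute)
    fix p assume "p \<in> P"
    then obtain i j where p: "p = (i, j)" "i \<in> I" "j \<in> I" using T by (auto simp: P_def)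
    have "transpose (sum X T) = sum X T"
      unfolding transpose_sum using T by (intro sum.cong refl symmetric_X) auto
    with p show "transpose (- \<theta> *\<^sub>R (case p of (i, j) \<Rightarrow> Z i j)) = - \<theta> *\<^sub>R (case p of (i, j) \<Rightarrow> Z i j)"
      by (simp only: transpose_scaleR Z_def transpose_plus transpose_minus symmetric_X prod.case)
  qed (simp add: w_def)
  then have "texp (- \<theta> *\<^sub>R sum X T) \<le> w * (\<Sum>p\<in>P. texp (- \<theta> *\<^sub>R (case p of (i, j) \<Rightarrow> Z i j)))"
    unfolding mean sum_distrib_left .
  from mult_left_mono[OF this, of "real (card P)"]
  have "real (card P) * texp (- \<theta> *\<^sub>R sum X T) \<le> (w * real (card P)) * (\<Sum>p\<in>P. texp (- \<theta> *\<^sub>R (case p of (i, j) \<Rightarrow> Z i j)))"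
    by (simp only: mult_ac of_nat_0_le_iff)
  then have "Suc k * k * texp (- \<theta> *\<^sub>R sum X T) \<le> (\<Sum>p\<in>P. texp (- \<theta> *\<^sub>R (case p of (i, j) \<Rightarrow> Z i j)))"
    unfolding w1 unfolding cardP by (simp only: mult_1)
  also have "\<dots> = (\<Sum>i\<in>T. \<Sum>j\<in>T - {i}. texp (- \<theta> *\<^sub>R Z i j))"
    unfolding P_def using finT by (subst sum.Sigma) (auto simp: case_prod_unfold)
  also have "\<dots> = (\<Sum>i\<in>T. \<Sum>j\<in>T - {i}. texp (- \<theta> *\<^sub>R (sum X (T - {i}) + X j)))"
    using finT by (intro sum.cong refl) (simp add: Z_def sum_diff1)
  finally show ?thesis .
qed

text \<open>An independent draw added to a \<open>k\<close>-subset \<open>S\<close> is either new or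
  repeats an element of \<open>S\<close>. New draws reproduce the sum over the subsets of size
  \<open>Suc k\<close>, repeated draws are bounded below by \<open>texp_exchange\<close>, and
  \<open>texp_step\<close> bounds both together from above.\<close>

lemma sum_texp_subsets_Suc:
  assumes "0 \<le> \<theta>" "k < card I"
  shows "Suc k * (\<Sum>T | T \<subseteq> I \<and> card T = Suc k. texp (- \<theta> *\<^sub>R sum X T))
    \<le> (card I - k) * rate \<theta> * (\<Sum>S | S \<subseteq> I \<and> card S = k. texp (- \<theta> *\<^sub>R sum X S))"
proof -
  define C where "C m = {S. S \<subseteq> I \<and> card S = m}" for m
  define \<Phi> where "\<Phi> S j = texp (- \<theta> *\<^sub>R (sum X S + X j))" for S j
  define U where "U m = (\<Sum>T\<in>C m. texp (- \<theta> *\<^sub>R sum X T))" for m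
  define n where "n = card I"
  have fin: "finite S" if "S \<in> C m" for S m
    using that finite_I finite_subset by (auto simp: C_def)
  have "(\<Sum>S\<in>C k. \<Sum>j\<in>I - S. \<Phi> S j) = (\<Sum>T\<in>C (Suc k). \<Sum>j\<in>T. \<Phi> (T - {j}) j)"
    unfolding C_def by (rule sum_subsets_insert[OF finite_I])
  also have "\<dots> = (\<Sum>T\<in>C (Suc k). Suc k * texp (- \<theta> *\<^sub>R sum X T))"
  proof (intro sum.cong refl)
    fix T assume T: "T \<in> C (Suc k)"
    have "(\<Sum>j\<in>T. \<Phi> (T - {j}) j) = (\<Sum>j\<in>T. texp (- \<theta> *\<^sub>R sum X T))"
      using fin[OF T] by (intro sum.cong refl) (simp add: \<Phi>_def sum_diff1)
    then show "(\<Sum>j\<in>T. \<Phi> (T - {j}) j) = Suc k * texp (- \<theta> *\<^sub>R sum X T)"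
      using T by (simp add: C_def)
  qed
  finally have new: "(\<Sum>S\<in>C k. \<Sum>j\<in>I - S. \<Phi> S j) = Suc k * U (Suc k)"
    by (simp add: U_def sum_distrib_left)
  \<comment> \<open>The repeated draws: each pair of \<open>S\<close> and \<open>j\<close> in
    \<open>S\<close> is counted \<open>n - k\<close> times, once for every \<open>i\<close> outside
    \<open>S\<close>.\<close>
  have "Suc k * k * U (Suc k) \<le> (\<Sum>T\<in>C (Suc k). \<Sum>i\<in>T. \<Sum>j\<in>T - {i}. \<Phi> (T - {i}) j)"
    unfolding U_def \<Phi>_def sum_distrib_left by (intro sum_mono texp_exchange) (auto simp: C_def)
  also have "\<dots> = (\<Sum>S\<in>C k. \<Sum>i\<in>I - S. \<Sum>j\<in>S. \<Phi> S j)"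
    unfolding C_def by (rule sum_subsets_insert[OF finite_I, symmetric])
  also have "\<dots> = (\<Sum>S\<in>C k. (n - k) * (\<Sum>j\<in>S. \<Phi> S j))"
    using fin by (intro sum.cong refl) (auto simp: C_def card_Diff_subset n_def)
  finally have old: "Suc k * k * U (Suc k) \<le> (n - k) * (\<Sum>S\<in>C k. \<Sum>j\<in>S. \<Phi> S j)"
    by (simp add: sum_distrib_left)
  have "(\<Sum>S\<in>C k. \<Sum>j\<in>I. \<Phi> S j) \<le> (\<Sum>S\<in>C k. n * rate \<theta> * texp (- \<theta> *\<^sub>R sum X S))"
  proof (rule sum_mono)
    fix S assume "S \<in> C k"
    then have "transpose (sum X S) = sum X S"
      unfolding transpose_sum by (intro sum.cong refl symmetric_X) (auto simp: C_def)
    then have "transpose (- \<theta> *\<^sub>R sum X S) = - \<theta> *\<^sub>R sum X S" by (simp only: transpose_scaleR)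
    from texp_step[OF this assms(1)]
    show "(\<Sum>j\<in>I. \<Phi> S j) \<le> n * rate \<theta> * texp (- \<theta> *\<^sub>R sum X S)"
      by (simp add: \<Phi>_def n_def scaleR_right_distrib)
  qed
  also have "(\<Sum>S\<in>C k. \<Sum>j\<in>I. \<Phi> S j)
      = (\<Sum>S\<in>C k. \<Sum>j\<in>I - S. \<Phi> S j) + (\<Sum>S\<in>C k. \<Sum>j\<in>S. \<Phi> S j)"
    unfolding sum.distrib[symmetric] using finite_I
    by (intro sum.cong refl) (auto simp: C_def intro: sum.subset_diff)
  finally have all: "Suc k * U (Suc k) + (\<Sum>S\<in>C k. \<Sum>j\<in>S. \<Phi> S j) \<le> n * rate \<theta> * U k"
    by (simp add: new U_def sum_distrib_left)
  have nk: "real (n - k) = real n - k" "0 < real n - k" using assms by (auto simp: n_def)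
  \<comment> \<open>The repeated draws complete \<open>n - k\<close> copies of the sum over new
    draws to \<open>n\<close> copies, so that \<open>n\<close> cancels against the factor in
    \<open>all\<close>.\<close>
  have "n * (Suc k * U (Suc k)) = (n - k) * (Suc k * U (Suc k)) + Suc k * k * U (Suc k)"
    by (simp only: nk) (simp add: algebra_simps)
  also have "\<dots> \<le> (n - k) * (Suc k * U (Suc k) + (\<Sum>S\<in>C k. \<Sum>j\<in>S. \<Phi> S j))"
    using old by (simp add: distrib_left)
  also have "\<dots> \<le> (n - k) * (n * rate \<theta> * U k)"
    using all by (intro mult_left_mono) auto
  finally have "n * (Suc k * U (Suc k)) \<le> n * ((n - k) * rate \<theta> * U k)"
    by (simp add: mult_ac)
  then have "Suc k * U (Suc k) \<le> (n - k) * rate \<theta> * U k"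
    using assms(2) by (simp add: n_def mult_le_cancel_left)
  then show ?thesis by (simp add: U_def C_def n_def)
qed

lemma sum_texp_subsets:
  assumes "0 \<le> \<theta>" "k \<le> card I"
  shows "(\<Sum>S | S \<subseteq> I \<and> card S = k. texp (- \<theta> *\<^sub>R sum X S))
    \<le> (card I choose k) * (rate \<theta> ^ k * CARD('n))"
  using assms(2)
proof (induction k)
  case 0
  have "{S. S \<subseteq> I \<and> card S = 0} = {{}}" using finite_I finite_subset by fastforce
  then show ?case by (simp add: texp_zero)
next
  case (Suc k)
  define U where "U m = (\<Sum>S | S \<subseteq> I \<and> card S = m. texp (- \<theta> *\<^sub>R sum X S))" for m
  have "Suc k * U (Suc k) \<le> (card I - k) * rate \<theta> * U k"
    unfolding U_def using Suc.prems assms(1) by (intro sum_texp_subsets_Suc) auto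
  also have "\<dots> \<le> (card I - k) * rate \<theta> * ((card I choose k) * (rate \<theta> ^ k * CARD('n)))"
    unfolding U_def using Suc assms(1) rate_nonneg[of \<theta>] by (intro mult_left_mono) auto
  also have "\<dots> = real ((card I - k) * (card I choose k)) * (rate \<theta> ^ Suc k * CARD('n))"
    by simp
  also have "(card I - k) * (card I choose k) = Suc k * (card I choose Suc k)"
    using binomial_absorb_comp[of "card I" k] binomial_absorption[of k "card I"] by simp
  finally have "Suc k * U (Suc k) \<le> Suc k * ((card I choose Suc k) * (rate \<theta> ^ Suc k * CARD('n)))"
    by (simp only: of_nat_mult mult.assoc)
  then show ?case
    unfolding U_def by (rule mult_left_le_imp_le) simp
qed

text \<open>The sampled sum ignores order and every \<open>s\<close>-subset has
  \<open>fact s\<close> orderings, so the average over lists is the average over subsets.\<close>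

lemma expectation_texp_without_replacement:
  assumes "0 \<le> \<theta>" "s \<le> card I"
  shows "measure_pmf.expectation (pmf_of_set {xs. length xs = s \<and> distinct xs \<and> set xs \<subseteq> I})
      (\<lambda>xs. texp (- \<theta> *\<^sub>R (\<Sum>i\<leftarrow>xs. X i))) \<le> rate \<theta> ^ s * CARD('n)"
proof -
  define C where "C = {S. S \<subseteq> I \<and> card S = s}"
  define D where "D = {xs. length xs = s \<and> distinct xs \<and> set xs \<subseteq> I}"
  have finC: "finite C" using finite_I by (simp add: C_def)
  have cardC: "card C = card I choose s" using finite_I by (simp add: C_def n_subsets)
  have finS: "finite S" if "S \<in> C" for S using that finite_I finite_subset by (auto simp: C_def)
  have DU: "D = (\<Union>S\<in>C. permutations_of_set S)"
    by (auto simp: D_def C_def permutations_of_set_def distinct_card)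
  have sumD: "sum g D = (\<Sum>S\<in>C. \<Sum>xs\<in>permutations_of_set S. g xs)" for g :: "'i list \<Rightarrow> real"
    unfolding DU using finC
    by (intro sum.UNION_disjoint ballI impI finite_permutations_of_set)
      (auto dest: permutations_of_setD)
  have perm: "card (permutations_of_set S) = fact s" if "S \<in> C" for S
    using finS[OF that] that by (simp add: C_def)
  have finD: "finite D"
    unfolding DU using finC by (intro finite_UN_I) auto
  have "real (card D) = (\<Sum>xs\<in>D. 1)" by simp
  also have "\<dots> = real (card C * fact s)"
    unfolding sumD by (simp add: perm)
  finally have cardD: "real (card D) = card C * fact s" by simp
  have posC: "0 < real (card C)" using assms(2) by (simp add: cardC)
  then have "D \<noteq> {}" using cardD by auto
  then have "measure_pmf.expectation (pmf_of_set D) (\<lambda>xs. texp (- \<theta> *\<^sub>R (\<Sum>i\<leftarrow>xs. X i)))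
      = (\<Sum>xs\<in>D. texp (- \<theta> *\<^sub>R (\<Sum>i\<leftarrow>xs. X i))) / card D"
    using finD by (rule integral_pmf_of_set)
  also have "(\<Sum>xs\<in>D. texp (- \<theta> *\<^sub>R (\<Sum>i\<leftarrow>xs. X i))) = (\<Sum>S\<in>C. fact s * texp (- \<theta> *\<^sub>R sum X S))"
    unfolding sumD
  proof (intro sum.cong refl)
    fix S assume S: "S \<in> C"
    have "(\<Sum>xs\<in>permutations_of_set S. texp (- \<theta> *\<^sub>R (\<Sum>i\<leftarrow>xs. X i)))
        = (\<Sum>xs\<in>permutations_of_set S. texp (- \<theta> *\<^sub>R sum X S))"
      by (intro sum.cong refl) (simp add: permutations_of_set_def sum_list_distinct_conv_sum_set)
    then show "(\<Sum>xs\<in>permutations_of_set S. texp (- \<theta> *\<^sub>R (\<Sum>i\<leftarrow>xs. X i))) = fact s * texp (- \<theta> *\<^sub>R sum X S)"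
      by (simp add: perm[OF S])
  qed
  also have "\<dots> / card D = (\<Sum>S\<in>C. texp (- \<theta> *\<^sub>R sum X S)) / card C"
    by (simp add: cardD sum_distrib_left[symmetric])
  also have "\<dots> \<le> (card C * (rate \<theta> ^ s * CARD('n))) / card C"
  proof (rule divide_right_mono)
    show "(\<Sum>S\<in>C. texp (- \<theta> *\<^sub>R sum X S)) \<le> card C * (rate \<theta> ^ s * CARD('n))"
      unfolding cardC unfolding C_def by (rule sum_texp_subsets[OF assms])
  qed simp
  also have "\<dots> = rate \<theta> ^ s * CARD('n)"
    using posC by simp
  finally show ?thesis by (simp add: D_def)
qed

text \<open>Both sampling schemes satisfy the bound assumed on the expected trace, so the tail
  estimate is made once. A failing direction, normalised, makes the trace at least
  \<open>exp (- \<theta> * c)\<close>, and Markov's inequality finishes.\<close>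

lemma prob_small_form_le:
  fixes p :: "'i list pmf"
  assumes fin: "finite (set_pmf p)" and set_p: "\<And>xs. xs \<in> set_pmf p \<Longrightarrow> set xs \<subseteq> I"
    and texp: "\<And>\<theta>. 0 \<le> \<theta> \<Longrightarrow>
      measure_pmf.expectation p (\<lambda>xs. texp (- \<theta> *\<^sub>R (\<Sum>i\<leftarrow>xs. X i))) \<le> rate \<theta> ^ s * CARD('n)"
    and "0 \<le> \<epsilon>" "0 \<le> \<mu>"
  shows "measure_pmf.prob p {xs. \<exists>v. v \<bullet> ((\<Sum>i\<leftarrow>xs. X i) *v v) < (1 - \<epsilon>) * \<mu> * s * (v \<bullet> v)}
    \<le> CARD('n) * exp (- (s * \<mu> * \<epsilon>\<^sup>2 / (2 * R)))"
proof -
  \<comment> \<open>Minimises the exponent once \<open>exp (- t)\<close> is replaced by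
    \<open>1 - t + t^2 / 2\<close> at \<open>t = \<theta> * R\<close>.\<close>
  define \<theta> where "\<theta> = \<epsilon> / R"
  define c where "c = (1 - \<epsilon>) * \<mu> * s"
  have \<theta>: "0 \<le> \<theta>" "\<theta> * R = \<epsilon>" using assms R_pos by (simp_all add: \<theta>_def)
  have sym: "transpose (- \<theta> *\<^sub>R (\<Sum>i\<leftarrow>xs. X i)) = - \<theta> *\<^sub>R (\<Sum>i\<leftarrow>xs. X i)" if "set xs \<subseteq> I" for xs
  proof -
    have "transpose (\<Sum>i\<leftarrow>xs. X i) = (\<Sum>i\<leftarrow>xs. X i)"
      using that by (induction xs) (auto simp: transpose_zero transpose_plus symmetric_X)
    then show ?thesis by (simp only: transpose_scaleR)
  qed
  have "measure_pmf.prob p {xs. \<exists>v. v \<bullet> ((\<Sum>i\<leftarrow>xs. X i) *v v) < c * (v \<bullet> v)}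
    \<le> measure_pmf.expectation p (\<lambda>xs. texp (- \<theta> *\<^sub>R (\<Sum>i\<leftarrow>xs. X i))) / exp (- \<theta> * c)"
  proof (rule prob_le_expectation_div[OF fin])
    fix xs assume xs: "xs \<in> set_pmf p"
    note symS = sym[OF set_p[OF xs]]
    show "0 \<le> texp (- \<theta> *\<^sub>R (\<Sum>i\<leftarrow>xs. X i))"
      by (rule texp_nonneg[OF symS])
    assume "xs \<in> {xs. \<exists>v. v \<bullet> ((\<Sum>i\<leftarrow>xs. X i) *v v) < c * (v \<bullet> v)}"
    then obtain v where v: "v \<bullet> ((\<Sum>i\<leftarrow>xs. X i) *v v) < c * (v \<bullet> v)" by blast
    then have "v \<noteq> 0" by auto
    define u where "u = (1 / norm v) *\<^sub>R v"
    have "u \<bullet> ((\<Sum>i\<leftarrow>xs. X i) *v u) = v \<bullet> ((\<Sum>i\<leftarrow>xs. X i) *v v) / (v \<bullet> v)"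
      by (simp add: u_def matrix_vector_mult_scaleR power2_norm_eq_inner[symmetric] power2_eq_square)
    also have "\<dots> \<le> c"
      using v \<open>v \<noteq> 0\<close> by (simp add: pos_divide_le_eq)
    finally have u: "u \<bullet> ((\<Sum>i\<leftarrow>xs. X i) *v u) \<le> c" .
    have "exp (- \<theta> * c) \<le> exp (u \<bullet> ((- \<theta> *\<^sub>R (\<Sum>i\<leftarrow>xs. X i)) *v u))"
      using mult_left_mono[OF u \<theta>(1)]
      by (simp add: scaleR_matrix_vector_assoc[symmetric] del: scaleR_minus_left)
    also have "\<dots> \<le> texp (- \<theta> *\<^sub>R (\<Sum>i\<leftarrow>xs. X i))"
      using \<open>v \<noteq> 0\<close> by (intro exp_inner_le_texp symS) (simp add: u_def)
    finally show "exp (- \<theta> * c) \<le> texp (- \<theta> *\<^sub>R (\<Sum>i\<leftarrow>xs. X i))" .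
  qed simp
  also have "\<dots> \<le> rate \<theta> ^ s * CARD('n) / exp (- \<theta> * c)"
    by (intro divide_right_mono texp \<theta>) simp
  also have "\<dots> \<le> exp (- (\<epsilon> - \<epsilon>\<^sup>2 / 2) / R * \<mu>) ^ s * CARD('n) / exp (- \<theta> * c)"
  proof (intro divide_right_mono mult_right_mono power_mono rate_nonneg \<theta>)
    \<comment> \<open>The upper bound on \<open>exp (- \<epsilon>)\<close> comes from this lower
      bound on \<open>exp \<epsilon>\<close>, since the product of the two quadratics is
      \<open>1 + \<epsilon>^4 / 4\<close>.\<close>
    have "exp \<epsilon> \<ge> 1 + \<epsilon> + \<epsilon>\<^sup>2 / 2"
      using assms(4) by (rule exp_lower_Taylor_quadratic)
    then have "1 \<le> (1 - \<epsilon> + \<epsilon>\<^sup>2 / 2) * exp \<epsilon>"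
    proof -
      have pos: "0 \<le> 1 - \<epsilon> + \<epsilon>\<^sup>2 / 2"
        using zero_le_power2[of "\<epsilon> - 1"] by (simp add: power2_diff)
      have "1 \<le> (1 - \<epsilon> + \<epsilon>\<^sup>2 / 2) * (1 + \<epsilon> + \<epsilon>\<^sup>2 / 2)"
        using assms(4) by (simp add: algebra_simps power2_eq_square)
      also have "\<dots> \<le> (1 - \<epsilon> + \<epsilon>\<^sup>2 / 2) * exp \<epsilon>"
        using pos \<open>exp \<epsilon> \<ge> _\<close> by (intro mult_left_mono) auto
      finally show ?thesis .
    qed
    then have "exp (- \<epsilon>) \<le> 1 - \<epsilon> + \<epsilon>\<^sup>2 / 2"
      by (simp add: exp_minus field_simps)
    then have "(\<epsilon> - \<epsilon>\<^sup>2 / 2) / R * \<mu> \<le> (1 - exp (- \<epsilon>)) / R * \<mu>"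
      using R_pos \<open>0 \<le> \<mu>\<close> by (intro mult_right_mono divide_right_mono) auto
    then have "rate \<theta> \<le> 1 + (- (\<epsilon> - \<epsilon>\<^sup>2 / 2) / R * \<mu>)"
    proof -
      have "- (\<epsilon> - \<epsilon>\<^sup>2 / 2) / R * \<mu> = - ((\<epsilon> - \<epsilon>\<^sup>2 / 2) / R * \<mu>)"
        by (simp only: minus_divide_left[symmetric] mult_minus_left)
      moreover have "- \<theta> * R = - \<epsilon>" using \<theta> by simp
      then have "rate \<theta> = 1 - (1 - exp (- \<epsilon>)) / R * \<mu>" by (simp only: rate_def)
      ultimately show ?thesis
        using \<open>(\<epsilon> - \<epsilon>\<^sup>2 / 2) / R * \<mu> \<le> _\<close> by linarith
    qed
    also have "\<dots> \<le> exp (- (\<epsilon> - \<epsilon>\<^sup>2 / 2) / R * \<mu>)" by (rule exp_ge_add_one_self)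
    finally show "rate \<theta> \<le> exp (- (\<epsilon> - \<epsilon>\<^sup>2 / 2) / R * \<mu>)" .
  qed auto
  also have "exp e ^ s * a / exp (- \<theta> * c) = a * exp (s * e + \<theta> * c)" for e a :: real
    by (simp add: exp_add exp_of_nat_mult exp_of_nat2_mult exp_minus field_simps)
  \<comment> \<open>The terms linear in \<open>\<epsilon>\<close> cancel; what remains is
    \<open>\<epsilon>^2 / 2 - \<epsilon>^2\<close>, times \<open>s * \<mu> / R\<close>.\<close>
  also have "s * (- (\<epsilon> - \<epsilon>\<^sup>2 / 2) / R * \<mu>) + \<theta> * c = - (s * \<mu> * \<epsilon>\<^sup>2 / (2 * R))"
    using R_pos by (simp add: \<theta>_def c_def field_simps power2_eq_square)
  finally show ?thesis by (simp add: c_def)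
qed

end

subsection \<open>Concentration of a vector average\<close>

text \<open>Reduction to the centred case: \<open>f i - \<mu>\<close> ranges in an interval of the
  same length, and the factor \<open>exp (l * \<mu>)\<close> is restored afterwards.\<close>

lemma Hoeffding_lemma_finite:
  fixes f :: "'i \<Rightarrow> real"
  assumes I: "finite I" "I \<noteq> {}" and f: "\<And>i. i \<in> I \<Longrightarrow> f i \<in> {a..b}" and "0 < l"
  shows "(\<Sum>i\<in>I. exp (l * f i)) / card I \<le> exp (l * ((\<Sum>i\<in>I. f i) / card I) + l\<^sup>2 * (b - a)\<^sup>2 / 8)"
proof -
  define M where "M = measure_pmf (pmf_of_set I)"
  define \<mu> where "\<mu> = (\<Sum>i\<in>I. f i) / card I"
  have E: "integral\<^sup>L M g = sum g I / card I" for g :: "'i \<Rightarrow> real"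
    unfolding M_def using integral_pmf_of_set[OF I(2,1)] .
  have card: "0 < real (card I)" using I by (simp add: card_gt_0_iff)
  interpret M: interval_bounded_random_variable M "\<lambda>i. f i - \<mu>" "a - \<mu>" "b - \<mu>"
    unfolding M_def using I f
    by unfold_locales (auto simp: AE_measure_pmf_iff)
  have "integral\<^sup>L M (\<lambda>i. f i - \<mu>) = 0"
    unfolding E using card by (simp add: sum_subtractf \<mu>_def)
  from M.Hoeffdings_lemma_nn_integral_0[OF \<open>0 < l\<close> this]
  have "nn_integral M (\<lambda>i. exp (l * (f i - \<mu>))) \<le> ennreal (exp (l\<^sup>2 * (b - a)\<^sup>2 / 8))"
    by simp
  also have "nn_integral M (\<lambda>i. exp (l * (f i - \<mu>))) = ennreal (integral\<^sup>L M (\<lambda>i. exp (l * (f i - \<mu>))))"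
    unfolding M_def using I by (intro nn_integral_eq_integral integrable_measure_pmf_finite) auto
  finally have "integral\<^sup>L M (\<lambda>i. exp (l * (f i - \<mu>))) \<le> exp (l\<^sup>2 * (b - a)\<^sup>2 / 8)"
    by (simp add: ennreal_le_iff)
  then have "(\<Sum>i\<in>I. exp (l * f i)) / card I * exp (- (l * \<mu>)) \<le> exp (l\<^sup>2 * (b - a)\<^sup>2 / 8)"
    unfolding E by (simp add: right_diff_distrib exp_diff exp_minus sum_divide_distrib[symmetric] field_simps)
  then have "(\<Sum>i\<in>I. exp (l * f i)) / card I * exp (- (l * \<mu>)) * exp (l * \<mu>)
      \<le> exp (l\<^sup>2 * (b - a)\<^sup>2 / 8) * exp (l * \<mu>)"
    by (rule mult_right_mono) simp
  moreover have "y * exp (- z) * exp z = y" for y z :: real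
    by (simp add: exp_minus)
  ultimately have "(\<Sum>i\<in>I. exp (l * f i)) / card I \<le> exp (l\<^sup>2 * (b - a)\<^sup>2 / 8) * exp (l * \<mu>)"
    by (simp only:)
  then show ?thesis
    unfolding \<mu>_def[symmetric] exp_add by (simp only: mult.commute)
qed

section \<open>Bounded differences for the norm of a sum of centred draws\<close>

locale bounded_population =
  fixes w :: "'i \<Rightarrow> 'a::euclidean_space" and I :: "'i set" and G :: real
  assumes finite_I: "finite I" and I_nonempty: "I \<noteq> {}"
    and norm_w: "\<And>i. i \<in> I \<Longrightarrow> norm (w i) \<le> G"
    and G_pos: "0 < G"
begin

definition mean :: 'a where
  "mean = (\<Sum>i\<in>I. w i) /\<^sub>R card I"

definition Y :: "'i \<Rightarrow> 'a" where
  "Y i = w i - mean"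

text \<open>Expectation of \<open>h\<close> after \<open>s\<close> further draws from the partial
  sum \<open>z\<close>; the free starting point makes it the conditional expectation given the
  earlier draws.\<close>

definition EY :: "nat \<Rightarrow> ('a \<Rightarrow> real) \<Rightarrow> 'a \<Rightarrow> real" where
  "EY s h z = measure_pmf.expectation (replicate_pmf s (pmf_of_set I)) (\<lambda>xs. h (z + (\<Sum>i\<leftarrow>xs. Y i)))"

lemma card_I_pos: "0 < real (card I)"
  using finite_I I_nonempty by (simp add: card_gt_0_iff)

lemma finite_support: "finite (set_pmf (replicate_pmf s (pmf_of_set I)))"
  using finite_I I_nonempty by (intro finite_set_replicate_pmf) simp

lemma EY_0: "EY 0 h z = h z"
  by (simp add: EY_def)

lemma EY_Suc: "EY (Suc s) h z = (\<Sum>i\<in>I. EY s h (z + Y i)) / card I"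
  unfolding EY_def expectation_replicate_pmf_Suc[OF finite_I I_nonempty] by (simp add: add.assoc)

lemma sum_Y: "(\<Sum>i\<in>I. Y i) = 0"
  using card_I_pos by (simp add: Y_def mean_def sum_subtractf sum_constant_scaleR)

text \<open>The cross terms cancel because the \<open>Y i\<close> sum to zero, and a variance is at
  most the second moment. Hence \<open>G^2\<close>, and not the \<open>(2 * G)^2\<close> that a
  bound on \<open>norm (Y i)\<close> would give.\<close>

lemma sum_norm_Y: "(\<Sum>i\<in>I. (norm (z + Y i))\<^sup>2) \<le> card I * ((norm z)\<^sup>2 + G\<^sup>2)"
proof -
  have w: "(\<Sum>i\<in>I. w i) = card I *\<^sub>R mean"
    using card_I_pos by (simp add: mean_def)
  have "(\<Sum>i\<in>I. (norm (z + Y i))\<^sup>2)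
      = (\<Sum>i\<in>I. (norm z)\<^sup>2 + 2 * (z \<bullet> Y i) + (norm (w i))\<^sup>2 - 2 * (mean \<bullet> w i) + (norm mean)\<^sup>2)"
    by (intro sum.cong refl)
      (simp add: Y_def power2_norm_eq_inner algebra_simps inner_commute)
  also have "\<dots> = card I * (norm z)\<^sup>2 + 2 * (z \<bullet> (\<Sum>i\<in>I. Y i)) + (\<Sum>i\<in>I. (norm (w i))\<^sup>2)
      - 2 * (mean \<bullet> (\<Sum>i\<in>I. w i)) + card I * (norm mean)\<^sup>2"
    by (simp add: sum.distrib sum_subtractf inner_sum_right sum_distrib_left)
  also have "\<dots> = card I * (norm z)\<^sup>2 + (\<Sum>i\<in>I. (norm (w i))\<^sup>2) - card I * (norm mean)\<^sup>2"
    by (simp add: sum_Y w power2_norm_eq_inner)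
  also have "\<dots> \<le> card I * (norm z)\<^sup>2 + (\<Sum>i\<in>I. G\<^sup>2)"
  proof -
    have "(\<Sum>i\<in>I. (norm (w i))\<^sup>2) \<le> (\<Sum>i\<in>I. G\<^sup>2)"
      using norm_w by (intro sum_mono power_mono) auto
    moreover have "0 \<le> card I * (norm mean)\<^sup>2" by simp
    ultimately show ?thesis by linarith
  qed
  finally show ?thesis by (simp add: algebra_simps)
qed

lemma EY_norm_square: "EY s (\<lambda>y. (norm y)\<^sup>2) z \<le> (norm z)\<^sup>2 + s * G\<^sup>2"
proof (induction s arbitrary: z)
  case (Suc s)
  have "EY (Suc s) (\<lambda>y. (norm y)\<^sup>2) z \<le> (\<Sum>i\<in>I. (norm (z + Y i))\<^sup>2 + s * G\<^sup>2) / card I"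
    unfolding EY_Suc by (intro divide_right_mono sum_mono Suc.IH) simp
  also have "\<dots> \<le> (card I * ((norm z)\<^sup>2 + G\<^sup>2) + card I * (s * G\<^sup>2)) / card I"
    unfolding sum.distrib by (intro divide_right_mono add_mono sum_norm_Y) auto
  also have "\<dots> = (norm z)\<^sup>2 + Suc s * G\<^sup>2"
    using card_I_pos by (simp add: field_simps)
  finally show ?case .
qed (simp add: EY_0)

lemma EY_norm_0: "EY s norm 0 \<le> G * sqrt s"
proof (cases "s = 0")
  case False
  \<comment> \<open>In place of Jensen for the square root: \<open>y^2 / (2 * c) + c / 2\<close>
    lies above \<open>y\<close>, and this \<open>c\<close> makes the bounds on both summands equal
    to \<open>c / 2\<close>.\<close>
  define c where "c = G * sqrt s"
  have c: "0 < c" "c\<^sup>2 = s * G\<^sup>2" using False G_pos by (simp_all add: c_def power_mult_distrib)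
  have "norm y \<le> (norm y)\<^sup>2 / (2 * c) + c / 2" for y :: 'a
    using sum_squares_bound[of "norm y" c] c(1) by (simp add: field_simps power2_eq_square)
  then have "EY s norm 0 \<le> EY s (\<lambda>y. (norm y)\<^sup>2 / (2 * c) + c / 2) 0"
    unfolding EY_def by (intro integral_mono integrable_measure_pmf_finite finite_support)
  also have "\<dots> = EY s (\<lambda>y. (norm y)\<^sup>2) 0 / (2 * c) + c / 2"
    unfolding EY_def by (simp add: integrable_measure_pmf_finite finite_support)
  also have "\<dots> \<le> (s * G\<^sup>2) / (2 * c) + c / 2"
    using EY_norm_square[of s 0] c by (intro add_mono divide_right_mono) auto
  also have "\<dots> = c"
    using c(1) unfolding c(2)[symmetric] by (simp add: field_simps power2_eq_square)
  finally show ?thesis by (simp add: c_def)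
qed (simp add: EY_0)

lemma EY_norm_Lipschitz: "\<bar>EY s norm y - EY s norm z\<bar> \<le> norm (y - z)"
proof -
  have "\<bar>EY s norm y - EY s norm z\<bar> = \<bar>measure_pmf.expectation (replicate_pmf s (pmf_of_set I))
      (\<lambda>xs. norm (y + (\<Sum>i\<leftarrow>xs. Y i)) - norm (z + (\<Sum>i\<leftarrow>xs. Y i)))\<bar>"
    unfolding EY_def by (simp add: integrable_measure_pmf_finite finite_support)
  also have "\<dots> \<le> measure_pmf.expectation (replicate_pmf s (pmf_of_set I)) (\<lambda>xs. norm (y - z))"
  proof (rule integral_abs_bound[THEN order_trans], intro integral_mono integrable_measure_pmf_finite finite_support)
    fix xs :: "'i list"
    show "\<bar>norm (y + (\<Sum>i\<leftarrow>xs. Y i)) - norm (z + (\<Sum>i\<leftarrow>xs. Y i))\<bar> \<le> norm (y - z)"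
      using norm_triangle_ineq3[of "y + (\<Sum>i\<leftarrow>xs. Y i)" "z + (\<Sum>i\<leftarrow>xs. Y i)"] by simp
  qed
  finally show ?thesis by simp
qed

text \<open>The martingale argument: the first draw is singled out, the induction hypothesis handles
  the others from \<open>z + Y i\<close>, and Hoeffding's lemma is applied to the conditional mean
  as a function of \<open>i\<close>.\<close>

lemma EY_exp_norm:
  assumes "0 < l"
  shows "EY s (\<lambda>y. exp (l * norm y)) z \<le> exp (l * EY s norm z + s * (l\<^sup>2 * G\<^sup>2 / 2))"
proof (induction s arbitrary: z)
  case (Suc s)
  \<comment> \<open>The point \<open>z + Y i\<close> is \<open>z - mean\<close> shifted by
    \<open>w i\<close>, so the Lipschitz bound confines all values to an interval of length
    \<open>2 * G\<close>; then \<open>(b - a)^2 / 8\<close> is \<open>G^2 / 2\<close>.\<close>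
  define a b where "a = EY s norm (z - mean) - G" and "b = EY s norm (z - mean) + G"
  have mid: "EY s norm (z + Y i) \<in> {a..b}" if "i \<in> I" for i
    using EY_norm_Lipschitz[of s "z + Y i" "z - mean"] norm_w[OF that]
    by (simp add: a_def b_def Y_def abs_le_iff)
  have "EY (Suc s) (\<lambda>y. exp (l * norm y)) z
      \<le> (\<Sum>i\<in>I. exp (l * EY s norm (z + Y i) + s * (l\<^sup>2 * G\<^sup>2 / 2))) / card I"
    unfolding EY_Suc by (intro divide_right_mono sum_mono Suc.IH) simp
  also have "\<dots> = (\<Sum>i\<in>I. exp (l * EY s norm (z + Y i))) / card I * exp (s * (l\<^sup>2 * G\<^sup>2 / 2))"
    by (simp add: exp_add sum_distrib_right)
  also have "\<dots> \<le> exp (l * EY (Suc s) norm z + l\<^sup>2 * (b - a)\<^sup>2 / 8) * exp (s * (l\<^sup>2 * G\<^sup>2 / 2))"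
    unfolding EY_Suc
    by (intro mult_right_mono Hoeffding_lemma_finite finite_I I_nonempty mid assms) auto
  also have "\<dots> = exp (l * EY (Suc s) norm z + Suc s * (l\<^sup>2 * G\<^sup>2 / 2))"
    by (simp add: exp_add[symmetric] a_def b_def power2_eq_square algebra_simps)
  finally show ?case .
qed (simp add: EY_0)

lemma prob_norm_sum_le:
  assumes s: "0 < s" and \<delta>: "0 < \<delta>" "\<delta> < 1" and size: "G * (1 + sqrt (8 * ln (1 / \<delta>))) \<le> t / sqrt s"
  shows "measure_pmf.prob (replicate_pmf s (pmf_of_set I)) {xs. t < norm (\<Sum>i\<leftarrow>xs. Y i)} \<le> \<delta>"
proof -
  define r where "r = sqrt s"
  define L where "L = sqrt (8 * ln (1 / \<delta>))"
  have r: "0 < r" "r\<^sup>2 = s" using s by (simp_all add: r_def)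
  have L2: "L\<^sup>2 = 8 * ln (1 / \<delta>)" and L: "0 < L"
    using \<delta> by (simp_all add: L_def)
  \<comment> \<open>Minimises \<open>s * l^2 * G^2 / 2 - l * G * r * L\<close>, the exponent that
    remains after the mean \<open>G * r\<close> is taken off \<open>t\<close>.\<close>
  define l where "l = L / (r * G)"
  have l: "0 < l" using L r G_pos by (simp add: l_def)
  have "measure_pmf.prob (replicate_pmf s (pmf_of_set I)) {xs. t < norm (\<Sum>i\<leftarrow>xs. Y i)}
      \<le> measure_pmf.expectation (replicate_pmf s (pmf_of_set I)) (\<lambda>xs. exp (l * norm (0 + (\<Sum>i\<leftarrow>xs. Y i)))) / exp (l * t)"
    using l by (intro prob_le_expectation_div finite_support) auto
  also have "\<dots> \<le> exp (l * EY s norm 0 + s * (l\<^sup>2 * G\<^sup>2 / 2)) / exp (l * t)"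
    using EY_exp_norm[OF l, of s 0] unfolding EY_def by (intro divide_right_mono) auto
  also have "\<dots> = exp (l * EY s norm 0 + s * (l\<^sup>2 * G\<^sup>2 / 2) - l * t)"
    by (simp add: exp_diff)
  also have "\<dots> \<le> exp (ln \<delta>)"
  proof -
    have "l * EY s norm 0 \<le> l * (G * r)"
      using EY_norm_0[of s] l by (simp add: r_def)
    also have "\<dots> = L" using r G_pos by (simp add: l_def)
    finally have 1: "l * EY s norm 0 \<le> L" .
    have 2: "s * (l\<^sup>2 * G\<^sup>2 / 2) = L\<^sup>2 / 2"
      using r(1) G_pos unfolding r(2)[symmetric] by (simp add: l_def power_divide power_mult_distrib)
    have "G * (1 + L) * r \<le> t"
      using size r(1) unfolding L_def r_def by (simp only: pos_le_divide_eq)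
    then have "l * (r * (G * (1 + L))) \<le> l * t"
      using l by (intro mult_left_mono) (simp_all add: mult.commute)
    moreover have "l * (r * (G * (1 + L))) = L * (1 + L)"
      using r(1) G_pos by (simp add: l_def)
    ultimately have "l * EY s norm 0 + s * (l\<^sup>2 * G\<^sup>2 / 2) - l * t \<le> - (L\<^sup>2 / 2)"
      using 1 2 by (simp add: power2_eq_square algebra_simps)
    \<comment> \<open>The left side is \<open>4 * ln \<delta>\<close>, and the logarithm is
      negative.\<close>
    also have "\<dots> \<le> ln \<delta>"
      using \<delta> unfolding L2 by (simp add: ln_div)
    finally show ?thesis by simp
  qed
  finally show ?thesis using \<delta> by simp
qed

end

subsection \<open>Gradients and Hessians\<close>

lemma has_derivative_grad:
  fixes f :: "real^'n \<Rightarrow> real"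
  assumes "f differentiable (at x)"
  shows "(f has_derivative (\<lambda>h. grad f x \<bullet> h)) (at x)"
proof -
  let ?D = "frechet_derivative f (at x)"
  have D: "(f has_derivative ?D) (at x)" using assms frechet_derivative_works by blast
  then have lin: "linear ?D" by (rule has_derivative_linear)
  have "?D h = grad f x \<bullet> h" for h
  proof -
    have "?D h = ?D (\<Sum>i\<in>UNIV. h $ i *\<^sub>R axis i 1)"
      using basis_expansion[of h] by (simp add: scalar_mult_eq_scaleR)
    also have "\<dots> = (\<Sum>i\<in>UNIV. h $ i * ?D (axis i 1))"
      by (simp add: linear_sum[OF lin] linear_scale[OF lin])
    finally show ?thesis by (simp add: grad_def inner_vec_def mult.commute)
  qed
  with D show ?thesis by (metis (no_types, lifting) ext)
qed

lemma grad_eqI: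
  fixes f :: "real^'n \<Rightarrow> real"
  assumes "(f has_derivative (\<lambda>h. g \<bullet> h)) (at x)"
  shows "grad f x = g"
proof -
  have "frechet_derivative f (at x) = (\<lambda>h. g \<bullet> h)"
    using assms frechet_derivative_at by metis
  then show ?thesis by (simp add: grad_def inner_axis vec_eq_iff)
qed

lemma has_derivative_hessian:
  assumes "grad f differentiable (at x)"
  shows "(grad f has_derivative (\<lambda>h. hessian f x *v h)) (at x)"
  using assms jacobian_works unfolding hessian_def by blast

lemma hessian_eqI:
  fixes f :: "real^'n \<Rightarrow> real"
  assumes "(grad f has_derivative (\<lambda>h. H *v h)) (at x)"
  shows "hessian f x = H"
proof -
  have "frechet_derivative (grad f) (at x) = (\<lambda>h. H *v h)"
    using assms frechet_derivative_at by metis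
  then show ?thesis by (simp add: hessian_def jacobian_def)
qed

context
  fixes f :: "'i \<Rightarrow> real^'n \<Rightarrow> real" and I :: "'i set" and c :: real
  assumes diff: "\<And>i. i \<in> I \<Longrightarrow> twice_differentiable (f i)"
begin

lemma has_derivative_scaled_sum:
  "((\<lambda>y. c * (\<Sum>i\<in>I. f i y)) has_derivative (\<lambda>h. (c *\<^sub>R (\<Sum>i\<in>I. grad (f i) x)) \<bullet> h)) (at x)"
proof -
  have "((\<lambda>y. c * (\<Sum>i\<in>I. f i y)) has_derivative (\<lambda>h. c * (\<Sum>i\<in>I. grad (f i) x \<bullet> h))) (at x)"
    using diff by (intro has_derivative_mult_right has_derivative_sum has_derivative_grad)
      (auto simp: twice_differentiable_def)
  then show ?thesis by (simp add: inner_sum_left)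
qed

lemma grad_scaled_sum:
  "grad (\<lambda>y. c * (\<Sum>i\<in>I. f i y)) = (\<lambda>x. c *\<^sub>R (\<Sum>i\<in>I. grad (f i) x))"
  by (intro ext grad_eqI has_derivative_scaled_sum)

lemma has_derivative_grad_scaled_sum:
  "(grad (\<lambda>y. c * (\<Sum>i\<in>I. f i y)) has_derivative (\<lambda>h. (c *\<^sub>R (\<Sum>i\<in>I. hessian (f i) x)) *v h)) (at x)"
proof -
  have "((\<lambda>x. c *\<^sub>R (\<Sum>i\<in>I. grad (f i) x)) has_derivative
      (\<lambda>h. c *\<^sub>R (\<Sum>i\<in>I. hessian (f i) x *v h))) (at x)"
    using diff by (intro has_derivative_scaleR_right has_derivative_sum has_derivative_hessian)
      (auto simp: twice_differentiable_def)
  moreover have "(\<Sum>i\<in>I. hessian (f i) x *v h) = (\<Sum>i\<in>I. hessian (f i) x) *v h" for h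
    by (induction I rule: infinite_finite_induct) (simp_all add: matrix_vector_mult_add_rdistrib)
  ultimately show ?thesis
    unfolding grad_scaled_sum by (simp add: scaleR_matrix_vector_assoc)
qed

lemma hessian_scaled_sum:
  "hessian (\<lambda>y. c * (\<Sum>i\<in>I. f i y)) x = c *\<^sub>R (\<Sum>i\<in>I. hessian (f i) x)"
  by (intro hessian_eqI has_derivative_grad_scaled_sum)

lemma twice_differentiable_scaled_sum: "twice_differentiable (\<lambda>y. c * (\<Sum>i\<in>I. f i y))"
  unfolding twice_differentiable_def
  using has_derivative_scaled_sum has_derivative_grad_scaled_sum by (blast intro: differentiableI)

end

text \<open>Maclaurin's formula on the line through \<open>x\<close> in direction \<open>p\<close>.
  The Lagrange remainder suits \<open>twice_differentiable\<close>, which gives existence of second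
  derivatives rather than continuity.\<close>

lemma Taylor_second_order:
  fixes F :: "real^'n \<Rightarrow> real"
  assumes "twice_differentiable F"
  obtains y where "F (x + p) = F x + grad F x \<bullet> p + (p \<bullet> (hessian F y *v p)) / 2"
proof -
  define h where "h t = F (x + t *\<^sub>R p)" for t
  define h' where "h' t = grad F (x + t *\<^sub>R p) \<bullet> p" for t
  define h'' where "h'' t = p \<bullet> (hessian F (x + t *\<^sub>R p) *v p)" for t
  define D where "D m = (if m = 0 then h else if m = 1 then h' else h'')" for m :: nat
  have line: "((\<lambda>t. x + t *\<^sub>R p) has_derivative (\<lambda>s. s *\<^sub>R p)) (at t)" for t
    by (auto intro!: derivative_eq_intros)
  have 0: "(h has_real_derivative h' t) (at t)" for t
  proof -
    have "(F has_derivative (\<lambda>v. grad F (x + t *\<^sub>R p) \<bullet> v)) (at (x + t *\<^sub>R p))"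
      using assms by (intro has_derivative_grad) (simp add: twice_differentiable_def)
    from has_derivative_compose[OF line this] show ?thesis
      unfolding h_def h'_def has_field_derivative_def by (simp add: mult.commute[of _ "grad _ _ \<bullet> _"])
  qed
  have 1: "(h' has_real_derivative h'' t) (at t)" for t
  proof -
    have "(grad F has_derivative (\<lambda>v. hessian F (x + t *\<^sub>R p) *v v)) (at (x + t *\<^sub>R p))"
      using assms by (intro has_derivative_hessian) (simp add: twice_differentiable_def)
    from has_derivative_inner_left[OF has_derivative_compose[OF line this], of p] show ?thesis
      unfolding h'_def h''_def has_field_derivative_def
      by (simp add: matrix_vector_mult_scaleR inner_commute mult.commute[of _ "p \<bullet> _"])
  qed
  have "\<exists>t>0. t < 1 \<and> h 1 = (\<Sum>m<2. D m 0 / fact m * 1 ^ m) + D 2 t / fact 2 * 1 ^ 2"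
    using 0 1 by (intro Maclaurin) (auto simp: D_def less_2_cases_iff)
  then obtain t where "h 1 = h 0 + h' 0 + h'' t / 2"
    by (auto simp: D_def numeral_2_eq_2)
  with that show ?thesis by (auto simp: h_def h'_def h''_def)
qed

subsection \<open>One step of the inexact Newton iteration\<close>

lemma loewner_le_scaled_identity:
  fixes A :: "real^'n^'n"
  shows "A \<preceq>\<^sub>L c *\<^sub>R mat 1 \<Longrightarrow> v \<bullet> (A *v v) \<le> c * (v \<bullet> v)"
    and "c *\<^sub>R mat 1 \<preceq>\<^sub>L A \<Longrightarrow> c * (v \<bullet> v) \<le> v \<bullet> (A *v v)"
  by (auto simp: loewner_le_def psd_def matrix_vector_mult_diff_rdistrib inner_diff_right
      scaleR_matrix_vector_assoc[symmetric] dest!: spec[of _ v])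

text \<open>Cauchy--Schwarz for the form of \<open>H\<close> at \<open>H *v p\<close> and
  \<open>p\<close>, divided by the squared norm of \<open>H *v p\<close>: the inequality
  \<open>H^2 \<le> b H\<close> without a square root of \<open>H\<close>.\<close>

lemma norm_matrix_vector_square_le:
  fixes H :: "real^'n^'n"
  assumes sym: "transpose H = H" and pos: "\<And>v. 0 \<le> v \<bullet> (H *v v)"
    and le: "\<And>v. v \<bullet> (H *v v) \<le> b * (v \<bullet> v)"
  shows "(norm (H *v p))\<^sup>2 \<le> b * (p \<bullet> (H *v p))"
proof (cases "H *v p = 0")
  case False
  define N where "N = (norm (H *v p))\<^sup>2"
  have N: "0 < N" using False by (simp add: N_def)
  have "N\<^sup>2 = ((H *v p) \<bullet> (H *v p))\<^sup>2" by (simp add: N_def power2_norm_eq_inner)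
  also have "\<dots> \<le> ((H *v p) \<bullet> (H *v (H *v p))) * (p \<bullet> (H *v p))"
    by (rule psd_Cauchy_Schwarz[OF sym subspace_UNIV pos]) auto
  also have "\<dots> \<le> (b * N) * (p \<bullet> (H *v p))"
    using le[of "H *v p"] by (intro mult_right_mono pos) (simp add: N_def power2_norm_eq_inner)
  finally have "N * N \<le> N * (b * (p \<bullet> (H *v p)))"
    by (simp add: power2_eq_square mult_ac)
  with N show ?thesis unfolding N_def[symmetric] by (simp only: mult_le_cancel_left_pos)
qed simp

text \<open>The Polyak--Lojasiewicz inequality: the quadratic lower model of \<open>F\<close> around
  \<open>x\<close> is bounded below by completing the square.\<close>

lemma strong_convexity_gap:
  fixes F :: "real^'n \<Rightarrow> real"
  assumes F: "twice_differentiable F" and "0 < \<gamma>"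
    and low: "\<And>y v. \<gamma> * (v \<bullet> v) \<le> v \<bullet> (hessian F y *v v)"
  shows "F x - F z \<le> (norm (grad F x))\<^sup>2 / (2 * \<gamma>)"
proof -
  define g p where "g = grad F x" and "p = z - x"
  obtain y where y: "F (x + p) = F x + g \<bullet> p + (p \<bullet> (hessian F y *v p)) / 2"
    unfolding g_def by (rule Taylor_second_order[OF F])
  have "0 \<le> (norm (g + \<gamma> *\<^sub>R p))\<^sup>2" by simp
  also have "\<dots> = (norm g)\<^sup>2 + 2 * \<gamma> * (g \<bullet> p) + \<gamma>\<^sup>2 * (p \<bullet> p)"
    unfolding power2_norm_eq_inner
    by (simp add: inner_add_left inner_add_right inner_commute power2_eq_square)
  finally have "- (g \<bullet> p) - \<gamma> * (p \<bullet> p) / 2 \<le> (norm g)\<^sup>2 / (2 * \<gamma>)"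
    using \<open>0 < \<gamma>\<close> by (simp add: field_simps power2_eq_square)
  moreover have "x + p = z" by (simp add: p_def)
  ultimately show ?thesis
    using y low[of p y] by (simp add: g_def)
qed

text \<open>The deterministic half. \<open>\<kappa> * \<gamma>\<close> bounds the spectrum of
  \<open>H\<close> from above, so \<open>\<kappa>\<close> governs the decrease, whereas the
  curvature of \<open>F\<close> makes \<open>K / \<gamma>\<close> govern the step size.\<close>

lemma inexact_Newton_step:
  fixes F :: "real^'n \<Rightarrow> real" and H :: "real^'n^'n" and g x :: "real^'n"
    and K \<gamma> \<epsilon>\<^sub>1 \<epsilon>\<^sub>2 \<beta> \<sigma> \<kappa> \<alpha>max :: real
  defines "p \<equiv> - (matrix_inv H *v g)"
  defines "\<alpha> \<equiv> step_size F \<alpha>max \<beta> x p g"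
  assumes F: "twice_differentiable F" and \<gamma>: "0 < \<gamma>" "\<gamma> \<le> K"
    and low: "\<And>y v. \<gamma> * (v \<bullet> v) \<le> v \<bullet> (hessian F y *v v)"
    and up: "\<And>y v. v \<bullet> (hessian F y *v v) \<le> K * (v \<bullet> v)"
    and \<epsilon>: "0 < \<epsilon>\<^sub>1" "\<epsilon>\<^sub>1 \<le> 1 / 2" "0 < \<epsilon>\<^sub>2" and \<beta>: "0 < \<beta>" "\<beta> < 1" and "1 \<le> \<alpha>max"
    and \<sigma>: "4 * \<kappa> / (1 - \<beta>) \<le> \<sigma>"
    and sym: "transpose H = H"
    and H_low: "\<And>v. (1 - \<epsilon>\<^sub>1) * \<gamma> * (v \<bullet> v) \<le> v \<bullet> (H *v v)"
    and H_up: "\<And>v. v \<bullet> (H *v v) \<le> \<kappa> * \<gamma> * (v \<bullet> v)"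
    and g: "norm (g - grad F x) \<le> \<epsilon>\<^sub>2" "\<sigma> * \<epsilon>\<^sub>2 \<le> norm g"
  shows "invertible H"
    and "F (x + \<alpha> *\<^sub>R p) - F z \<le> (1 - 8 * \<alpha> * \<beta> / (9 * \<kappa>)) * (F x - F z)"
    and "(1 - \<beta>) * (1 - \<epsilon>\<^sub>1) / (K / \<gamma>) \<le> \<alpha>"
proof -
  have half: "\<gamma> / 2 * (v \<bullet> v) \<le> (1 - \<epsilon>\<^sub>1) * \<gamma> * (v \<bullet> v)" for v :: "real^'n"
    using \<epsilon> \<gamma> mult_right_mono[of "1 / 2" "1 - \<epsilon>\<^sub>1" \<gamma>] by (intro mult_right_mono) auto
  have pos: "0 \<le> v \<bullet> (H *v v)" for v
    using half[of v] H_low[of v] \<gamma> by (meson inner_ge_zero mult_nonneg_nonneg order_trans half_gt_zero less_imp_le)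
  have "v = 0" if "H *v v = 0" for v
  proof -
    have "\<gamma> / 2 * (v \<bullet> v) \<le> 0" using half[of v] H_low[of v] that by simp
    then have "v \<bullet> v \<le> 0" using \<gamma> by (simp add: mult_le_0_iff)
    then have "v \<bullet> v = 0" by (intro order_antisym inner_ge_zero)
    then show ?thesis by (simp only: inner_eq_zero_iff)
  qed
  then show inv: "invertible H"
    by (simp add: invertible_left_inverse matrix_left_invertible_ker)
  then have "H ** matrix_inv H = mat 1"
    unfolding invertible_def matrix_inv_def by (rule someI2_ex) simp
  then have Hp: "H *v p = - g"
    by (simp add: p_def linear_neg[OF matrix_vector_mul_linear] matrix_vector_mul_assoc)
  define q where "q = p \<bullet> (H *v p)"
  have pg: "p \<bullet> g = - q" using Hp by (simp add: q_def)
  have q0: "0 \<le> q" unfolding q_def by (rule pos)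
  have "\<gamma> / 2 * (v \<bullet> v) \<le> \<kappa> * \<gamma> * (v \<bullet> v)" for v :: "real^'n"
    using half[of v] H_low[of v] H_up[of v] by linarith
  from this[of "axis undefined 1"] have \<kappa>: "1 / 2 \<le> \<kappa>"
    using \<gamma> by (simp add: inner_axis_axis)
  have ng: "(norm g)\<^sup>2 \<le> \<kappa> * \<gamma> * q"
    using norm_matrix_vector_square_le[OF sym pos H_up, of p] by (simp add: Hp q_def)
  have gp: "norm g \<le> \<kappa> * \<gamma> * norm p"
  proof (cases "g = 0")
    case False
    have q: "q \<le> norm p * norm g"
      using Cauchy_Schwarz_ineq2[of p g] pg by linarith
    have "0 \<le> \<kappa> * \<gamma>" using \<kappa> \<gamma> by simp
    then have "norm g * norm g \<le> (\<kappa> * \<gamma> * norm p) * norm g"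
      using ng mult_left_mono[OF q] by (fastforce simp: power2_eq_square mult.assoc)
    then show ?thesis using False by simp
  qed (use \<kappa> \<gamma> in auto)
  have "4 * \<kappa> \<le> \<sigma> * (1 - \<beta>)" using \<sigma> \<beta> by (simp add: pos_divide_le_eq)
  then have "4 * \<kappa> * \<epsilon>\<^sub>2 \<le> \<sigma> * (1 - \<beta>) * \<epsilon>\<^sub>2" using \<epsilon> by (intro mult_right_mono) auto
  also have "\<dots> \<le> (1 - \<beta>) * norm g"
    using g(2) \<beta> mult_left_mono[of "\<sigma> * \<epsilon>\<^sub>2" "norm g" "1 - \<beta>"] by (simp add: mult_ac)
  finally have \<epsilon>g: "4 * \<kappa> * \<epsilon>\<^sub>2 \<le> (1 - \<beta>) * norm g" .
  \<comment> \<open>The threshold bounds the error by \<open>norm g\<close>, and \<open>gp\<close>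
    trades \<open>norm g\<close> for \<open>norm p\<close>. The factor 4 pays for two halvings:
    \<open>1 - \<epsilon>\<^sub>1\<close> is at least \<open>1 / 2\<close>, and only half of the
    slack may be spent.\<close>
  have \<epsilon>p: "\<epsilon>\<^sub>2 * norm p \<le> (1 - \<beta>) * q / 2"
  proof -
    have "4 * \<kappa> * (\<epsilon>\<^sub>2 * norm p) \<le> (1 - \<beta>) * norm g * norm p"
      using mult_right_mono[OF \<epsilon>g, of "norm p"] by (simp add: mult.assoc)
    also have "\<dots> \<le> (1 - \<beta>) * (\<kappa> * \<gamma> * norm p) * norm p"
      using gp \<beta> by (intro mult_right_mono mult_left_mono) auto
    also have "\<dots> = 4 * \<kappa> * ((1 - \<beta>) * (\<gamma> / 2 * (p \<bullet> p)) / 2)"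
      by (simp add: power2_norm_eq_inner[symmetric] power2_eq_square)
    also have "\<dots> \<le> 4 * \<kappa> * ((1 - \<beta>) * q / 2)"
      using order_trans[OF half H_low, of p] \<kappa> \<beta>
      by (intro mult_left_mono divide_right_mono) (auto simp: q_def)
    finally show ?thesis by (rule mult_left_le_imp_le) (use \<kappa> in simp)
  qed
  \<comment> \<open>Chosen so that \<open>\<alpha>\<^sub>0 * K * (p \<bullet> p)\<close> is at most
    \<open>(1 - \<beta>) * q\<close>. Being admissible and at most \<open>\<alpha>max\<close>, it
    bounds the greatest admissible step from below.\<close>
  define \<alpha>\<^sub>0 where "\<alpha>\<^sub>0 = (1 - \<beta>) * (1 - \<epsilon>\<^sub>1) / (K / \<gamma>)"
  have \<alpha>0: "0 < \<alpha>\<^sub>0" using \<beta> \<epsilon> \<gamma> by (simp add: \<alpha>\<^sub>0_def)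
  have "\<alpha>\<^sub>0 = (1 - \<beta>) * (1 - \<epsilon>\<^sub>1) * (\<gamma> / K)" by (simp add: \<alpha>\<^sub>0_def)
  also have "\<dots> \<le> 1 * 1 * 1"
    using \<beta> \<epsilon> \<gamma> by (intro mult_mono) auto
  finally have \<alpha>0_le: "\<alpha>\<^sub>0 \<le> \<alpha>max" using \<open>1 \<le> \<alpha>max\<close> by simp
  have "continuous_on UNIV F"
    using F by (auto simp: twice_differentiable_def continuous_on_eq_continuous_at
        intro: differentiable_imp_continuous_within)
  note step = step_size_greatest[OF this, where \<alpha>max = \<alpha>max and \<beta> = \<beta> and x = x and p = p and g = g,
      folded \<alpha>_def]
  have "armijo F \<beta> x p g \<alpha>\<^sub>0"
  proof -
    obtain y where y: "F (x + \<alpha>\<^sub>0 *\<^sub>R p) = F x + grad F x \<bullet> (\<alpha>\<^sub>0 *\<^sub>R p)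
        + ((\<alpha>\<^sub>0 *\<^sub>R p) \<bullet> (hessian F y *v (\<alpha>\<^sub>0 *\<^sub>R p))) / 2"
      by (rule Taylor_second_order[OF F])
    have "grad F x \<bullet> p = p \<bullet> g - (g - grad F x) \<bullet> p"
      by (simp add: inner_diff_left inner_diff_right inner_commute)
    also have "\<dots> \<le> - q + \<epsilon>\<^sub>2 * norm p"
      using Cauchy_Schwarz_ineq2[of "g - grad F x" p] mult_right_mono[OF g(1) norm_ge_zero[of p]] pg by linarith
    finally have lin: "grad F x \<bullet> p \<le> - q + (1 - \<beta>) * q / 2" using \<epsilon>p by linarith
    have "(\<alpha>\<^sub>0 *\<^sub>R p) \<bullet> (hessian F y *v (\<alpha>\<^sub>0 *\<^sub>R p)) = \<alpha>\<^sub>0 * (\<alpha>\<^sub>0 * (p \<bullet> (hessian F y *v p)))"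
      by (simp add: matrix_vector_mult_scaleR)
    also have "\<dots> \<le> \<alpha>\<^sub>0 * (\<alpha>\<^sub>0 * (K * (p \<bullet> p)))"
      using \<alpha>0 up by (intro mult_left_mono) auto
    also have "\<alpha>\<^sub>0 * (K * (p \<bullet> p)) = (1 - \<beta>) * ((1 - \<epsilon>\<^sub>1) * \<gamma> * (p \<bullet> p))"
      using \<gamma> by (simp add: \<alpha>\<^sub>0_def)
    also have "\<alpha>\<^sub>0 * \<dots> \<le> \<alpha>\<^sub>0 * ((1 - \<beta>) * q)"
      using \<alpha>0 \<beta> H_low[of p] unfolding q_def by (intro mult_left_mono) auto
    finally have quad: "(\<alpha>\<^sub>0 *\<^sub>R p) \<bullet> (hessian F y *v (\<alpha>\<^sub>0 *\<^sub>R p)) \<le> \<alpha>\<^sub>0 * ((1 - \<beta>) * q)" .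
    \<comment> \<open>Gradient error and curvature each take half of the slack
      \<open>(1 - \<beta>) * q\<close>, which leaves exactly \<open>- \<beta> * q\<close>.\<close>
    have "F (x + \<alpha>\<^sub>0 *\<^sub>R p) \<le> F x + \<alpha>\<^sub>0 * (- q + (1 - \<beta>) * q / 2) + \<alpha>\<^sub>0 * ((1 - \<beta>) * q) / 2"
    proof -
      have "grad F x \<bullet> (\<alpha>\<^sub>0 *\<^sub>R p) \<le> \<alpha>\<^sub>0 * (- q + (1 - \<beta>) * q / 2)"
        unfolding inner_scaleR_right using lin \<alpha>0 by (intro mult_left_mono) auto
      with y quad show ?thesis by linarith
    qed
    also have "\<dots> = F x + \<alpha>\<^sub>0 * \<beta> * (p \<bullet> g)"
      by (simp add: pg algebra_simps)
    finally show ?thesis by (simp add: armijo_def)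
  qed
  then have \<alpha>: "\<alpha>\<^sub>0 \<le> \<alpha>" using step(3) \<alpha>0_le \<open>1 \<le> \<alpha>max\<close> by simp
  then show "(1 - \<beta>) * (1 - \<epsilon>\<^sub>1) / (K / \<gamma>) \<le> \<alpha>" by (simp add: \<alpha>\<^sub>0_def)
  \<comment> \<open>\<open>2 * \<epsilon>\<^sub>2 \<le> norm g\<close> makes the true gradient at
    most \<open>3 / 2\<close> times \<open>norm g\<close>; squaring and dividing by
    \<open>2 * \<gamma>\<close> gives \<open>9 / 8\<close>.\<close>
  have gap: "8 / (9 * \<kappa>) * (F x - F z) \<le> q"
  proof -
    have "2 * \<epsilon>\<^sub>2 \<le> norm g"
    proof -
      have "2 * \<epsilon>\<^sub>2 \<le> 4 * \<kappa> * \<epsilon>\<^sub>2" using \<kappa> \<epsilon> by (intro mult_right_mono) auto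
      also have "\<dots> \<le> 1 * norm g"
        using \<epsilon>g \<beta> by (intro order_trans[OF \<epsilon>g] mult_right_mono) auto
      finally show ?thesis by simp
    qed
    then have "norm (grad F x) \<le> 3 / 2 * norm g"
      using norm_triangle_sub[of "grad F x" g] g(1) by (simp add: norm_minus_commute)
    then have "(norm (grad F x))\<^sup>2 \<le> (3 / 2 * norm g)\<^sup>2" by (intro power_mono) auto
    also have "\<dots> \<le> 9 / 4 * (\<kappa> * \<gamma> * q)"
      using ng by (simp add: power2_eq_square)
    finally have "(norm (grad F x))\<^sup>2 / (2 * \<gamma>) \<le> 9 / 4 * (\<kappa> * \<gamma> * q) / (2 * \<gamma>)"
      using \<gamma> by (intro divide_right_mono) auto
    then have "F x - F z \<le> 9 / 8 * \<kappa> * q"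
      using strong_convexity_gap[OF F \<gamma>(1) low, of x z] \<gamma> by simp
    then show ?thesis using \<kappa> by (simp add: field_simps)
  qed
  have "F (x + \<alpha> *\<^sub>R p) \<le> F x - \<alpha> * \<beta> * q"
    using step(2) \<open>1 \<le> \<alpha>max\<close> by (simp add: armijo_def pg)
  moreover have "\<alpha> * \<beta> * (8 / (9 * \<kappa>) * (F x - F z)) \<le> \<alpha> * \<beta> * q"
    using gap \<alpha> \<alpha>0 \<beta> by (intro mult_left_mono) auto
  ultimately have "F (x + \<alpha> *\<^sub>R p) - F z \<le> (F x - F z) - \<alpha> * \<beta> * (8 / (9 * \<kappa>) * (F x - F z))"
    by linarith
  also have "\<dots> = (1 - 8 * \<alpha> * \<beta> / (9 * \<kappa>)) * (F x - F z)"
    by (simp add: algebra_simps)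
  finally show "F (x + \<alpha> *\<^sub>R p) - F z \<le> (1 - 8 * \<alpha> * \<beta> / (9 * \<kappa>)) * (F x - F z)" .
qed

subsection \<open>Averages of the largest values\<close>

text \<open>Greedy matching along \<open>xs\<close>: one element of \<open>ys\<close>, no larger
  than the current head, is paired with that head.\<close>

lemma sum_list_le_take_sorted:
  fixes xs :: "real list"
  assumes "sorted_wrt (\<ge>) xs" "mset ys \<subseteq># mset xs"
  shows "sum_list ys \<le> sum_list (take (length ys) xs)"
  using assms
proof (induction xs arbitrary: ys)
  case (Cons a xs)
  show ?case
  proof (cases ys)
    case ys: (Cons y ys')
    \<comment> \<open>Removing \<open>a\<close> itself when it occurs keeps the rest of
      \<open>ys\<close> inside the tail as a multiset; otherwise \<open>ys\<close> already lies in
      the tail and any element will do.\<close>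
    define b where "b = (if a \<in> set ys then a else y)"
    have b: "b \<in> set ys" by (simp add: b_def ys)
    have "set ys \<subseteq> insert a (set xs)"
      using set_mset_mono[OF Cons.prems(2)] by simp
    then have "b \<le> a" using Cons.prems(1) ys by (auto simp: b_def)
    have "mset (remove1 b ys) \<subseteq># mset xs"
    proof (cases "a \<in> set ys")
      case True
      then show ?thesis
        using Cons.prems(2) by (auto simp: b_def subset_eq_diff_conv)
    next
      case False
      have "mset ys \<subseteq># mset xs"
      proof (intro mset_subset_eqI)
        fix c show "count (mset ys) c \<le> count (mset xs) c"
          using mset_subset_eq_count[OF Cons.prems(2), of c] False
          by (cases "c = a") (auto simp: count_eq_zero_iff[THEN iffD2])
      qed
      then show ?thesis
        by (simp add: subset_mset.order_trans[OF diff_subset_eq_self])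
    qed
    then have "sum_list (remove1 b ys) \<le> sum_list (take (length (remove1 b ys)) xs)"
      using Cons.IH Cons.prems(1) by simp
    moreover have "sum_list ys = b + sum_list (remove1 b ys)"
      using b by (induction ys) auto
    moreover have "length ys = Suc (length (remove1 b ys))"
      using b length_pos_if_in_set[OF b] by (simp add: length_remove1)
    then have "sum_list (take (length ys) (a # xs)) = a + sum_list (take (length (remove1 b ys)) xs)"
      by (simp only: take_Suc_Cons sum_list.Cons)
    ultimately show ?thesis
      using \<open>b \<le> a\<close> by linarith
  qed simp
qed simp

lemma sum_list_le_avg_largest:
  assumes "distinct xs" "set xs \<subseteq> {1..n}" "xs \<noteq> []"
  shows "(\<Sum>i\<leftarrow>xs. Ks i) \<le> length xs * avg_largest n Ks (length xs)"
proof -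
  have "mset xs = mset_set (set xs)"
    by (rule mset_set_set[OF assms(1), symmetric])
  also have "\<dots> \<subseteq># mset_set {1..n}"
    using assms(2) by (intro subset_imp_msubset_mset_set) auto
  also have "{1..n} = set [1..<n+1]" by auto
  also have "mset_set (set [1..<n+1]) = mset [1..<n+1]"
    by (rule mset_set_set[OF distinct_upt])
  finally have "mset xs \<subseteq># mset [1..<n+1]" .
  then have "mset (map Ks xs) \<subseteq># mset (rev (sort (map Ks [1..<n+1])))"
    by (simp only: mset_map image_mset_subseteq_mono mset_rev mset_sort)
  moreover have "sorted_wrt (\<ge>) (rev (sort (map Ks [1..<n+1])))"
    by (simp add: sorted_wrt_rev)
  ultimately have "sum_list (map Ks xs) \<le> sum_list (take (length (map Ks xs)) (rev (sort (map Ks [1..<n+1]))))"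
    by (intro sum_list_le_take_sorted)
  then show ?thesis using assms by (simp add: avg_largest_def)
qed

lemma le_avg_largest_1: "i \<in> {1..n} \<Longrightarrow> Ks i \<le> avg_largest n Ks 1"
  using sum_list_le_avg_largest[of "[i]" n Ks] by simp

subsection \<open>The two samples\<close>

lemma prob_pair_pmf_ge:
  assumes p: "a \<le> measure_pmf.prob p A" and q: "b \<le> measure_pmf.prob q B" and "0 \<le> a" "0 \<le> b"
    and E: "\<And>x y. x \<in> set_pmf p \<Longrightarrow> x \<in> A \<Longrightarrow> y \<in> set_pmf q \<Longrightarrow> y \<in> B \<Longrightarrow> (x, y) \<in> E"
  shows "a * b \<le> measure_pmf.prob (pair_pmf p q) E"
proof -
  have "a * b \<le> measure_pmf.prob p A * measure_pmf.prob q B"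
    using assms by (intro mult_mono) auto
  \<comment> \<open>Intersecting with the supports makes both events countable, as the product
    formula requires.\<close>
  also have "\<dots> = measure_pmf.prob p (A \<inter> set_pmf p) * measure_pmf.prob q (B \<inter> set_pmf q)"
    by (simp add: measure_Int_set_pmf)
  also have "\<dots> = measure_pmf.prob (pair_pmf p q) ((A \<inter> set_pmf p) \<times> (B \<inter> set_pmf q))"
    by (intro measure_pmf_prob_product[symmetric]) (auto intro: countable_subset[OF _ countable_set_pmf])
  also have "\<dots> \<le> measure_pmf.prob (pair_pmf p q) E"
    using E by (intro measure_pmf.finite_measure_mono) auto
  finally show ?thesis .
qed

lemma prob_Compl_ge: "measure_pmf.prob p {x. \<not> P x} \<le> \<delta> \<Longrightarrow> 1 - \<delta> \<le> measure_pmf.prob p {x. P x}"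
  using measure_pmf.prob_compl[of "{x. P x}" p] by (simp add: Compl_eq_Diff_UNIV[symmetric] Collect_neg_eq)

lemma set_pmf_sample:
  assumes "1 \<le> n" "mode = Without_Replacement \<Longrightarrow> s \<le> n"
  shows "finite (set_pmf (sample mode n s))"
    and "xs \<in> set_pmf (sample mode n s) \<Longrightarrow>
      length xs = s \<and> set xs \<subseteq> {1..n} \<and> (mode = Without_Replacement \<longrightarrow> distinct xs)"
proof -
  have ne: "{1..n} \<noteq> {}" using assms(1) by simp
  have "finite (set_pmf (sample mode n s)) \<and> (xs \<in> set_pmf (sample mode n s) \<longrightarrow>
      length xs = s \<and> set xs \<subseteq> {1..n} \<and> (mode = Without_Replacement \<longrightarrow> distinct xs))"
  proof (cases mode)
    case With_Replacement
    have "finite (set_pmf (replicate_pmf s (pmf_of_set {1..n})))"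
      using ne by (intro finite_set_replicate_pmf) simp
    with With_Replacement ne show ?thesis by (auto simp: set_replicate_pmf)
  next
    case Without_Replacement
    define D where "D = {xs. length xs = s \<and> distinct xs \<and> set xs \<subseteq> {1..n}}"
    have "D \<subseteq> {xs. set xs \<subseteq> {1..n} \<and> length xs = s}" by (auto simp: D_def)
    then have "finite D" using finite_lists_length_eq[of "{1..n}" s] finite_subset by auto
    \<comment> \<open>A witness of nonemptiness, which \<open>pmf_of_set\<close> requires; it exists
      because the size is at most \<open>n\<close>.\<close>
    moreover have "[1..<s+1] \<in> D"
      using assms(2) Without_Replacement by (auto simp: D_def)
    then have "D \<noteq> {}" by blast
    ultimately have "set_pmf (sample mode n s) = D"
      using Without_Replacement by (simp add: D_def)
    with \<open>finite D\<close> show ?thesis by (auto simp: D_def)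
  qed
  then show "finite (set_pmf (sample mode n s))"
    and "xs \<in> set_pmf (sample mode n s) \<Longrightarrow>
      length xs = s \<and> set xs \<subseteq> {1..n} \<and> (mode = Without_Replacement \<longrightarrow> distinct xs)"
    by blast+
qed

lemma inner_sum_list_matrix:
  fixes X :: "'i \<Rightarrow> real^'n^'n"
  shows "v \<bullet> ((\<Sum>i\<leftarrow>xs. X i) *v v) = (\<Sum>i\<leftarrow>xs. v \<bullet> (X i *v v))"
  by (induction xs) (simp_all add: matrix_vector_mult_add_rdistrib inner_add_right)

text \<open>Here the schemes differ: with repetition every draw may carry the largest value, while
  distinct draws collect at most the \<open>s\<close> largest.\<close>

lemma cond_tilde_bound:
  assumes "\<gamma> \<noteq> 0" "length xs = s" "set xs \<subseteq> {1..n}" "mode = Without_Replacement \<Longrightarrow> distinct xs" "xs \<noteq> []"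
  shows "(\<Sum>i\<leftarrow>xs. Ks i) \<le> s * (cond_tilde mode n Ks \<gamma> s * \<gamma>)"
proof (cases mode)
  case With_Replacement
  have "(\<Sum>i\<leftarrow>xs. Ks i) \<le> (\<Sum>i\<leftarrow>xs. avg_largest n Ks 1)"
    using assms(3) by (intro sum_list_mono le_avg_largest_1) auto
  with With_Replacement assms show ?thesis
    by (simp add: cond_number_def sum_list_triv)
next
  case Without_Replacement
  with assms show ?thesis
    using sum_list_le_avg_largest[of xs n Ks] by (simp add: cond_number_def)
qed

lemma prob_sub_grad:
  fixes f :: "nat \<Rightarrow> real^'p \<Rightarrow> real"
  assumes n: "1 \<le> n" and \<delta>: "0 < \<delta>" "\<delta> < 1" and "0 < \<epsilon>"
    and G: "\<And>i. i \<in> {1..n} \<Longrightarrow> norm (grad (f i) x) \<le> G"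
    and size: "real s \<ge> G\<^sup>2 / \<epsilon>\<^sup>2 * (1 + sqrt (8 * ln (1 / \<delta>)))\<^sup>2"
  shows "1 - \<delta> \<le> measure_pmf.prob (sample With_Replacement n s)
    {S. norm (sub_grad f x S - (1 / real n) *\<^sub>R (\<Sum>i=1..n. grad (f i) x)) \<le> \<epsilon>}"
proof (rule prob_Compl_ge, cases "G = 0")
  \<comment> \<open>Treated apart because the size condition then admits an empty sample and
    \<open>bounded_population\<close> asks for \<open>0 < G\<close>. All gradients vanish, so the
    error is zero.\<close>
  case True
  have zero: "grad (f i) x = 0" if "i \<in> {1..n}" for i
    using G[OF that] True by simp
  have "norm (sub_grad f x S - (1 / real n) *\<^sub>R (\<Sum>i=1..n. grad (f i) x)) \<le> \<epsilon>"
    if "S \<in> set_pmf (sample With_Replacement n s)" for S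
  proof -
    have "set S \<subseteq> {1..n}" using set_pmf_sample(2)[OF n _ that] by simp
    then have "(\<Sum>j\<leftarrow>S. grad (f j) x) = 0"
      by (induction S) (auto simp: zero)
    then show ?thesis using zero \<open>0 < \<epsilon>\<close> by (simp add: sub_grad_def)
  qed
  then have "measure_pmf.prob (sample With_Replacement n s)
      {S. \<not> norm (sub_grad f x S - (1 / real n) *\<^sub>R (\<Sum>i=1..n. grad (f i) x)) \<le> \<epsilon>} = 0"
    by (subst measure_pmf_zero_iff) blast
  with \<delta> show "measure_pmf.prob (sample With_Replacement n s)
      {S. \<not> norm (sub_grad f x S - (1 / real n) *\<^sub>R (\<Sum>i=1..n. grad (f i) x)) \<le> \<epsilon>} \<le> \<delta>"
    by simp
next
  case False
  have "0 \<le> G" using G[of 1] n norm_ge_zero[of "grad (f 1) x"] by (simp add: order_trans[OF norm_ge_zero])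
  with False have "0 < G" by simp
  interpret bounded_population "\<lambda>i. grad (f i) x" "{1..n}" G
    using n G \<open>0 < G\<close> by unfold_locales auto
  define L where "L = sqrt (8 * ln (1 / \<delta>))"
  have L: "0 \<le> L" using \<delta> by (simp add: L_def)
  have "(G * (1 + L) / \<epsilon>)\<^sup>2 \<le> s"
    using size unfolding L_def[symmetric] by (simp add: power_divide power_mult_distrib)
  then have sqrt: "G * (1 + L) / \<epsilon> \<le> sqrt s" by (rule real_le_rsqrt)
  moreover have "0 < G * (1 + L) / \<epsilon>" using \<open>0 < G\<close> L \<open>0 < \<epsilon>\<close> by simp
  ultimately have s: "0 < s" by (metis less_le_trans of_nat_0_less_iff real_sqrt_gt_0_iff)
  have "real s = sqrt s * sqrt s" by simp
  then have "s * \<epsilon> / sqrt s = sqrt s * \<epsilon>"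
    using s by (metis nonzero_mult_div_cancel_left of_nat_0_less_iff less_irrefl mult.assoc real_sqrt_gt_0_iff)
  moreover have "G * (1 + L) \<le> sqrt s * \<epsilon>"
    using sqrt \<open>0 < \<epsilon>\<close> by (simp only: pos_divide_le_eq)
  ultimately have "G * (1 + L) \<le> s * \<epsilon> / sqrt s" by simp
  \<comment> \<open>The threshold is \<open>t = s * \<epsilon>\<close>; its hypothesis on
    \<open>t / sqrt s\<close> is the square root of the size condition.\<close>
  from prob_norm_sum_le[OF s \<delta> this[unfolded L_def]]
  have tail: "measure_pmf.prob (sample With_Replacement n s) {S. s * \<epsilon> < norm (\<Sum>i\<leftarrow>S. Y i)} \<le> \<delta>"
    by simp
  have m: "mean = (1 / real n) *\<^sub>R (\<Sum>i=1..n. grad (f i) x)"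
    unfolding mean_def by (simp add: inverse_eq_divide)
  have "s * \<epsilon> < norm (\<Sum>i\<leftarrow>S. Y i)"
    if "S \<in> set_pmf (sample With_Replacement n s)" "\<not> norm (sub_grad f x S - mean) \<le> \<epsilon>" for S
  proof -
    have len: "length S = s" using set_pmf_sample(2)[OF n _ that(1)] by simp
    have "(\<Sum>i\<leftarrow>S. Y i) = (\<Sum>i\<leftarrow>S. grad (f i) x) - real (length S) *\<^sub>R mean"
      by (induction S) (simp_all add: Y_def algebra_simps del: One_nat_def)
    also have "\<dots> = real s *\<^sub>R (sub_grad f x S - mean)"
      using s by (simp add: sub_grad_def len scaleR_right_diff_distrib)
    finally show ?thesis using that(2) s by simp
  qed
  then have "measure_pmf.prob (sample With_Replacement n s) {S. \<not> norm (sub_grad f x S - mean) \<le> \<epsilon>}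
      \<le> measure_pmf.prob (sample With_Replacement n s) {S. s * \<epsilon> < norm (\<Sum>i\<leftarrow>S. Y i)}"
    by (intro measure_pmf.finite_measure_mono_AE) (auto simp: AE_measure_pmf_iff)
  with tail show "measure_pmf.prob (sample With_Replacement n s)
      {S. \<not> norm (sub_grad f x S - (1 / real n) *\<^sub>R (\<Sum>i=1..n. grad (f i) x)) \<le> \<epsilon>} \<le> \<delta>"
    unfolding m by linarith
qed

text \<open>Only the lower bound is random: symmetry and the upper bound hold for every sample in
  the support.\<close>

lemma prob_sub_hessian:
  fixes f :: "nat \<Rightarrow> real^'p \<Rightarrow> real"
  assumes n: "1 \<le> n" and \<delta>: "0 < \<delta>" "\<delta> < 1" and \<epsilon>: "0 < \<epsilon>" and \<gamma>: "0 < \<gamma>"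
    and Ks: "\<And>i. i \<in> {1..n} \<Longrightarrow> 0 < Ks i"
    and psd: "\<And>i. i \<in> {1..n} \<Longrightarrow> 0 \<preceq>\<^sub>L hessian (f i) x"
    and up: "\<And>i. i \<in> {1..n} \<Longrightarrow> hessian (f i) x \<preceq>\<^sub>L Ks i *\<^sub>R mat 1"
    and low: "\<gamma> *\<^sub>R mat 1 \<preceq>\<^sub>L (1 / real n) *\<^sub>R (\<Sum>i=1..n. hessian (f i) x)"
    and size: "real s \<ge> 2 * cond_number n Ks \<gamma> 1 * ln (real CARD('p) / \<delta>) / \<epsilon>\<^sup>2"
    and mode: "mode = Without_Replacement \<Longrightarrow> s \<le> n"
  shows "1 - \<delta> \<le> measure_pmf.prob (sample mode n s)
    {S. transpose (sub_hessian f x S) = sub_hessian f x S \<and>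
        (\<forall>v. (1 - \<epsilon>) * \<gamma> * (v \<bullet> v) \<le> v \<bullet> (sub_hessian f x S *v v)) \<and>
        (\<forall>v. v \<bullet> (sub_hessian f x S *v v) \<le> cond_tilde mode n Ks \<gamma> s * \<gamma> * (v \<bullet> v))}"
proof -
  define X where "X i = hessian (f i) x" for i
  define R where "R = avg_largest n Ks 1"
  have cond: "cond_number n Ks \<gamma> 1 = R / \<gamma>" by (simp add: cond_number_def R_def)
  have R: "0 < R" using Ks[of 1] le_avg_largest_1[of 1 n Ks] n by (simp add: R_def)
  have psdX: "transpose (X i) = X i" "0 \<le> v \<bullet> (X i *v v)" if "i \<in> {1..n}" for i v
    using psd[OF that] by (auto simp: X_def loewner_le_def psd_def)
  have upX: "v \<bullet> (X i *v v) \<le> Ks i * (v \<bullet> v)" if "i \<in> {1..n}" for i v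
    unfolding X_def by (rule loewner_le_scaled_identity(1)[OF up[OF that]])
  interpret psd_population X "{1..n}" R \<gamma>
  proof
    fix i :: nat and v :: "real^'p" assume i: "i \<in> {1..n}"
    show "v \<bullet> (X i *v v) \<le> R * (v \<bullet> v)"
      using upX[OF i, of v] mult_right_mono[OF le_avg_largest_1[OF i, of Ks], of "v \<bullet> v"]
      by (simp add: R_def)
  next
    fix v :: "real^'p"
    have "(\<Sum>i=1..n. v \<bullet> (X i *v v)) = v \<bullet> ((\<Sum>i=1..n. X i) *v v)"
      by (induction n) (simp_all add: matrix_vector_mult_add_rdistrib inner_add_right)
    then show "\<gamma> * (v \<bullet> v) * card {1..n} \<le> (\<Sum>i=1..n. v \<bullet> (X i *v v))"
      using loewner_le_scaled_identity(2)[OF low, of v] n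
      by (simp add: X_def scaleR_matrix_vector_assoc[symmetric] field_simps)
  qed (use n R psdX in auto)
  \<comment> \<open>A positive logarithm forces a nonempty sample; for an empty one, division by
    zero would make \<open>sub_hessian\<close> the zero matrix.\<close>
  have "real CARD('p) / \<delta> > 1"
    using \<delta> by (simp add: less_divide_eq order_less_le_trans[OF \<delta>(2)])
  then have "0 < 2 * cond_number n Ks \<gamma> 1 * ln (real CARD('p) / \<delta>) / \<epsilon>\<^sup>2"
    using R \<gamma> \<epsilon> unfolding cond by simp
  with size have s: "0 < s" by linarith
  have "measure_pmf.prob (sample mode n s)
      {S. \<exists>v. v \<bullet> ((\<Sum>i\<leftarrow>S. X i) *v v) < (1 - \<epsilon>) * \<gamma> * s * (v \<bullet> v)}
    \<le> CARD('p) * exp (- (s * \<gamma> * \<epsilon>\<^sup>2 / (2 * R)))"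
  proof (intro prob_small_form_le set_pmf_sample(1) n mode)
    show "set xs \<subseteq> {1..n}" if "xs \<in> set_pmf (sample mode n s)" for xs
      using set_pmf_sample(2)[OF n mode that] by simp
    show "measure_pmf.expectation (sample mode n s) (\<lambda>xs. texp (- \<theta> *\<^sub>R (\<Sum>i\<leftarrow>xs. X i)))
        \<le> rate \<theta> ^ s * CARD('p)" if "0 \<le> \<theta>" for \<theta>
    proof (cases mode)
      case With_Replacement
      then show ?thesis
        using expectation_texp_with_replacement[OF that transpose_zero, of s] by (simp add: texp_zero)
    next
      case Without_Replacement
      then show ?thesis
        using expectation_texp_without_replacement[OF that, of s] mode by simp
    qed
  qed (use \<epsilon> \<gamma> in auto)
  also have "\<dots> \<le> CARD('p) * exp (- ln (real CARD('p) / \<delta>))"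
  proof -
    \<comment> \<open>The size condition rearranged, with \<open>R / \<gamma>\<close> for the
      condition number; the exponential then cancels the dimension and leaves \<delta>.\<close>
    have "ln (real CARD('p) / \<delta>) \<le> s * \<gamma> * \<epsilon>\<^sup>2 / (2 * R)"
      using size R \<gamma> \<epsilon> unfolding cond by (simp add: field_simps)
    then show ?thesis by (intro mult_left_mono) auto
  qed
  also have "\<dots> = \<delta>" using \<delta> by (simp add: exp_minus)
  finally have "1 - \<delta> \<le> measure_pmf.prob (sample mode n s)
      {S. \<not> (\<exists>v. v \<bullet> ((\<Sum>i\<leftarrow>S. X i) *v v) < (1 - \<epsilon>) * \<gamma> * s * (v \<bullet> v))}"
    by (intro prob_Compl_ge) simp
  also have "\<dots> \<le> measure_pmf.prob (sample mode n s)
    {S. transpose (sub_hessian f x S) = sub_hessian f x S \<and>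
        (\<forall>v. (1 - \<epsilon>) * \<gamma> * (v \<bullet> v) \<le> v \<bullet> (sub_hessian f x S *v v)) \<and>
        (\<forall>v. v \<bullet> (sub_hessian f x S *v v) \<le> cond_tilde mode n Ks \<gamma> s * \<gamma> * (v \<bullet> v))}"
  proof (intro measure_pmf.finite_measure_mono_AE)
    have "transpose (sub_hessian f x S) = sub_hessian f x S \<and>
        (\<forall>v. (1 - \<epsilon>) * \<gamma> * (v \<bullet> v) \<le> v \<bullet> (sub_hessian f x S *v v)) \<and>
        (\<forall>v. v \<bullet> (sub_hessian f x S *v v) \<le> cond_tilde mode n Ks \<gamma> s * \<gamma> * (v \<bullet> v))"
      if S: "S \<in> set_pmf (sample mode n s)"
        and large: "\<And>v. (1 - \<epsilon>) * \<gamma> * s * (v \<bullet> v) \<le> v \<bullet> ((\<Sum>i\<leftarrow>S. X i) *v v)" for S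
    proof (intro conjI allI)
      have len: "length S = s" and sub: "set S \<subseteq> {1..n}" and dist: "mode = Without_Replacement \<Longrightarrow> distinct S"
        using set_pmf_sample(2)[OF n mode S] by auto
      have H: "sub_hessian f x S = (1 / real s) *\<^sub>R (\<Sum>i\<leftarrow>S. X i)"
        by (simp add: sub_hessian_def len X_def)
      have form: "v \<bullet> (sub_hessian f x S *v v) = v \<bullet> ((\<Sum>i\<leftarrow>S. X i) *v v) / s" for v
        by (simp add: H scaleR_matrix_vector_assoc[symmetric])
      have "transpose (\<Sum>i\<leftarrow>S. X i) = (\<Sum>i\<leftarrow>S. X i)"
        using sub by (induction S) (auto simp: transpose_zero transpose_plus psdX)
      then show "transpose (sub_hessian f x S) = sub_hessian f x S"
        by (simp only: H transpose_scaleR)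
      fix v :: "real^'p"
      show "(1 - \<epsilon>) * \<gamma> * (v \<bullet> v) \<le> v \<bullet> (sub_hessian f x S *v v)"
        using large[of v] s by (simp add: form pos_le_divide_eq mult_ac)
      have "S \<noteq> []" using len s by auto
      have "v \<bullet> ((\<Sum>i\<leftarrow>S. X i) *v v) \<le> (\<Sum>i\<leftarrow>S. Ks i * (v \<bullet> v))"
        unfolding inner_sum_list_matrix using sub by (intro sum_list_mono upX) auto
      also have "\<dots> = (\<Sum>i\<leftarrow>S. Ks i) * (v \<bullet> v)" by (rule sum_list_mult_const)
      also have "\<dots> \<le> (s * (cond_tilde mode n Ks \<gamma> s * \<gamma>)) * (v \<bullet> v)"
        using cond_tilde_bound[of \<gamma> S s n mode Ks] len sub dist \<open>S \<noteq> []\<close> \<gamma>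
        by (intro mult_right_mono) auto
      finally show "v \<bullet> (sub_hessian f x S *v v) \<le> cond_tilde mode n Ks \<gamma> s * \<gamma> * (v \<bullet> v)"
        using s by (simp add: form pos_divide_le_eq mult_ac)
    qed
    then show "AE S in sample mode n s. S \<in> {S. \<not> (\<exists>v. v \<bullet> ((\<Sum>i\<leftarrow>S. X i) *v v) < (1 - \<epsilon>) * \<gamma> * s * (v \<bullet> v))} \<longrightarrow>
      S \<in> {S. transpose (sub_hessian f x S) = sub_hessian f x S \<and>
        (\<forall>v. (1 - \<epsilon>) * \<gamma> * (v \<bullet> v) \<le> v \<bullet> (sub_hessian f x S *v v)) \<and>
        (\<forall>v. v \<bullet> (sub_hessian f x S *v v) \<le> cond_tilde mode n Ks \<gamma> s * \<gamma> * (v \<bullet> v))}"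
      unfolding AE_measure_pmf_iff mem_Collect_eq not_ex not_less by blast
  qed simp
  finally show ?thesis .
qed

section \<open>Combination of the two independent sampling events with the deterministic
  step\<close>

theorem theorem6:
  fixes f :: "nat \<Rightarrow> real^'p \<Rightarrow> real" and F :: "real^'p \<Rightarrow> real"
    and n :: nat and Ks :: "nat \<Rightarrow> real"
    and K \<gamma> \<delta> \<epsilon>\<^sub>1 \<epsilon>\<^sub>2 \<beta> \<alpha>max \<sigma> G \<kappa> \<kappa>\<^sub>1 \<kappa>t :: real
    and x xstar :: "real^'p"
    and mode :: sampling and sH sg :: nat
  assumes "1 \<le> n"
    and "\<And>i. i \<in> {1..n} \<Longrightarrow> twice_differentiable (f i)"
    and F: "F = (\<lambda>y. (1 / real n) * (\<Sum>i=1..n. f i y))"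
    and "\<And>i. i \<in> {1..n} \<Longrightarrow> 0 < Ks i"
    and "\<And>i y. i \<in> {1..n} \<Longrightarrow> 0 \<preceq>\<^sub>L hessian (f i) y"
    and "\<And>i y. i \<in> {1..n} \<Longrightarrow> hessian (f i) y \<preceq>\<^sub>L Ks i *\<^sub>R mat 1"
    and "0 < \<gamma>" "\<gamma> \<le> K"
    and "\<And>y. \<gamma> *\<^sub>R mat 1 \<preceq>\<^sub>L hessian F y"
    and "\<And>y. hessian F y \<preceq>\<^sub>L K *\<^sub>R mat 1"
    and xstar: "\<And>y. F xstar \<le> F y"
    and "0 < \<delta>" "\<delta> < 1" "0 < \<epsilon>\<^sub>1" "\<epsilon>\<^sub>1 \<le> 1 / 2" "0 < \<epsilon>\<^sub>2" "\<epsilon>\<^sub>2 < 1"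
    and "0 < \<beta>" "\<beta> < 1" "1 \<le> \<alpha>max"
    and "\<kappa> = K / \<gamma>" "\<kappa>\<^sub>1 = cond_number n Ks \<gamma> 1" "\<kappa>t = cond_tilde mode n Ks \<gamma> sH"
    and "\<sigma> \<ge> 4 * \<kappa>t / (1 - \<beta>)"
    and "real sH \<ge> 2 * \<kappa>\<^sub>1 * ln (real CARD('p) / \<delta>) / \<epsilon>\<^sub>1\<^sup>2"
    and "mode = Without_Replacement \<Longrightarrow> sH \<le> n"
    and "\<And>i. i \<in> {1..n} \<Longrightarrow> norm (grad (f i) x) \<le> G"
    and "real sg \<ge> G\<^sup>2 / \<epsilon>\<^sub>2\<^sup>2 * (1 + sqrt (8 * ln (1 / \<delta>)))\<^sup>2"
  shows "measure_pmf.prob (pair_pmf (sample mode n sH) (sample With_Replacement n sg))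
    {(SH, Sg).
       let H = sub_hessian f x SH;
           g = sub_grad f x Sg;
           p = - (matrix_inv H *v g);
           \<alpha> = step_size F \<alpha>max \<beta> x p g;
           x' = x + \<alpha> *\<^sub>R p;
           \<rho> = 8 * \<alpha> * \<beta> / (9 * \<kappa>t)
       in if norm g < \<sigma> * \<epsilon>\<^sub>2
          then norm (grad F x) < (1 + \<sigma>) * \<epsilon>\<^sub>2
          else invertible H \<and>
               F x' - F xstar \<le> (1 - \<rho>) * (F x - F xstar) \<and>
               \<alpha> \<ge> (1 - \<beta>) * (1 - \<epsilon>\<^sub>1) / \<kappa>}
    \<ge> (1 - \<delta>)\<^sup>2"
proof -
  let ?I = "{1..n}" and ?c = "1 / real n"
  note n = assms(1) and f_diff = assms(2) and Ks = assms(4) and f_low = assms(5) and f_up = assms(6)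
    and \<gamma> = assms(7,8) and F_low = assms(9) and F_up = assms(10) and \<delta> = assms(12,13)
    and \<epsilon>\<^sub>1 = assms(14,15) and \<epsilon>\<^sub>2 = assms(16) and \<beta> = assms(18,19) and \<alpha>max = assms(20)
    and \<kappa> = assms(21) and \<kappa>1 = assms(22) and \<kappa>t = assms(23) and \<sigma> = assms(24)
    and sH = assms(25) and mode = assms(26) and G = assms(27) and sg = assms(28)
  have F_diff: "twice_differentiable F"
    unfolding F by (rule twice_differentiable_scaled_sum) (rule f_diff)
  have grad_F: "grad F x = ?c *\<^sub>R (\<Sum>i=1..n. grad (f i) x)"
    unfolding F by (subst grad_scaled_sum) (auto intro: f_diff)
  have hess_F: "hessian F x = ?c *\<^sub>R (\<Sum>i=1..n. hessian (f i) x)"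
    unfolding F by (rule hessian_scaled_sum) (rule f_diff)
  have SH: "1 - \<delta> \<le> measure_pmf.prob (sample mode n sH)
    {S. transpose (sub_hessian f x S) = sub_hessian f x S \<and>
        (\<forall>v. (1 - \<epsilon>\<^sub>1) * \<gamma> * (v \<bullet> v) \<le> v \<bullet> (sub_hessian f x S *v v)) \<and>
        (\<forall>v. v \<bullet> (sub_hessian f x S *v v) \<le> \<kappa>t * \<gamma> * (v \<bullet> v))}"
    unfolding \<kappa>t
    using F_low[of x] sH[unfolded \<kappa>1]
    by (intro prob_sub_hessian n \<delta> \<epsilon>\<^sub>1(1) \<gamma>(1) Ks f_low f_up mode) (simp_all only: hess_F)
  have Sg: "1 - \<delta> \<le> measure_pmf.prob (sample With_Replacement n sg)
    {S. norm (sub_grad f x S - grad F x) \<le> \<epsilon>\<^sub>2}"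
    unfolding grad_F by (rule prob_sub_grad[OF n \<delta> \<epsilon>\<^sub>2 G sg])
  have "(1 - \<delta>) * (1 - \<delta>) \<le> measure_pmf.prob (pair_pmf (sample mode n sH) (sample With_Replacement n sg))
    {(SH, Sg).
       let H = sub_hessian f x SH;
           g = sub_grad f x Sg;
           p = - (matrix_inv H *v g);
           \<alpha> = step_size F \<alpha>max \<beta> x p g;
           x' = x + \<alpha> *\<^sub>R p;
           \<rho> = 8 * \<alpha> * \<beta> / (9 * \<kappa>t)
       in if norm g < \<sigma> * \<epsilon>\<^sub>2
          then norm (grad F x) < (1 + \<sigma>) * \<epsilon>\<^sub>2
          else invertible H \<and>
               F x' - F xstar \<le> (1 - \<rho>) * (F x - F xstar) \<and>
               \<alpha> \<ge> (1 - \<beta>) * (1 - \<epsilon>\<^sub>1) / \<kappa>}"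
  \<comment> \<open>Goal 3 is the deterministic implication from the two good events; the other two
    say that \<open>1 - \<delta>\<close> is nonnegative.\<close>
  proof (rule prob_pair_pmf_ge[OF SH Sg], goal_cases)
    case (3 SH Sg)
    define H g where "H = sub_hessian f x SH" and "g = sub_grad f x Sg"
    have H: "transpose H = H" "\<And>v. (1 - \<epsilon>\<^sub>1) * \<gamma> * (v \<bullet> v) \<le> v \<bullet> (H *v v)"
        "\<And>v. v \<bullet> (H *v v) \<le> \<kappa>t * \<gamma> * (v \<bullet> v)"
      and g: "norm (g - grad F x) \<le> \<epsilon>\<^sub>2"
      using 3 by (simp_all add: H_def g_def)
    show ?case
    proof (cases "norm g < \<sigma> * \<epsilon>\<^sub>2")
      case True
      have "norm (grad F x) \<le> norm g + norm (grad F x - g)" by (rule norm_triangle_sub)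
      then have "norm (grad F x) < (1 + \<sigma>) * \<epsilon>\<^sub>2"
        using True g by (simp add: norm_minus_commute algebra_simps)
      with True show ?thesis by (simp add: g_def Let_def)
    next
      case False
      then have "\<sigma> * \<epsilon>\<^sub>2 \<le> norm g" by simp
      note step = inexact_Newton_step[OF F_diff \<gamma> loewner_le_scaled_identity(2)[OF F_low]
          loewner_le_scaled_identity(1)[OF F_up] \<epsilon>\<^sub>1 \<epsilon>\<^sub>2 \<beta> \<alpha>max \<sigma> H g this]
      from step(1) step(2)[of xstar] step(3) False show ?thesis
        by (simp add: H_def[symmetric] g_def[symmetric] Let_def \<kappa>)
    qed
  qed (use \<delta> in simp_all)
  then show ?thesis by (simp only: power2_eq_square)
qed

end
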